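(* Let $1\le N\le\infty$, let $R$ be a $\mathbb Q$-algebra and let $\varepsilon\in\mathrm{Lie}(U_S^{\mathrm{MT}})(R)$ have Goncharov coefficients $c_w\in R$ with respect to chosen free generators $\tau_i$ ($1\le i\le d_1$) and $\sigma_{n,i}$ ($n\ge2$, $1\le i\le d_n$). Let $\xi\in\mathrm{Hom}_{\mathrm{gr}}(\mathrm{Lie}(U_S^{\mathrm{MT}}),\mathrm{Lie}(\Pi_{\mathrm{PL},N}^{\omega}))_R$ be a graded Lie algebra homomorphism defined over $R$ with coordinates $x_i,y_i,z_{n,i}\in R$ given by $\xi(\tau_i)=x_ie_0+y_ie_1$ and $\xi(\sigma_{n,i})=z_{n,i}\,\mathrm{ad}(e_0)^{n-1}e_1$. Then the cocycle evaluation map $\mathrm{ev}_\varepsilon:\xi\mapsto\xi(\varepsilon)$ is given by $$\mathrm{ev}_\varepsilon(\xi)=\sum_{i=1}^{d_1}c_{\tau_i}x_i\,e_0+\sum_{i=1}^{d_1}c_{\tau_i}y_i\,e_1+\sum_{n=2}^Nk_n\,\mathrm{ad}(e_0)^{n-1}e_1$$ with $$k_n=\sum_{i_1\le\dots\le i_{n-1}}\sum_{i_n}c'_{\tau_{i_1}\cdots\tau_{i_n}}x_{i_1}\cdots x_{i_{n-1}}y_{i_n}+\sum_{m=2}^n\sum_{i=1}^{d_m}\sum_{i_1\le\dots\le i_{n-m}}c_{\tau_{i_1}\cdots\tau_{i_{n-m}}\sigma_{m,i}}x_{i_1}\cdots x_{i_{n-m}}z_{m,i}$$ and $$c'_{\tau_{i_1}\cdots\tau_{i_n}}=\begin{cases}c_{\tau_{i_1}\cdots\tau_{i_n}}&\text{if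 }i_{n-1}>i_n,\\[1mm]-\displaystyle\sum_{\substack{j\in\{i_1,\dots,i_{n-1}\}\\ j<i_n}}c_{\tau_{i_1}\cdots\hat\tau_j\cdots\tau_{i_n}\tau_j}&\text{if }i_{n-1}\le i_n,\end{cases}$$ where all indices $i_1,\dots,i_n$ run over $\{1,\dots,d_1\}$, the last sum runs over the distinct values $j$ occurring among $i_1,\dots,i_{n-1}$ with $j<i_n$, and $\hat\tau_j$ means that one occurrence of $\tau_j$ is omitted.
   Context: Let $K$ be a number field and $S$ a finite set of primes of $K$. $\mathrm{MT}(\mathcal O_{K,S},\mathbb Q)$ is the category of mixed Tate motives over $\mathcal O_{K,S}$, with canonical fibre functor $\omega(M)=\bigoplus_n\mathrm{Hom}(\mathbb Q(-n),\mathrm{gr}^W_{2n}M)$ and Tannaka group $U_S^{\mathrm{MT}}\rtimes\mathbb G_m$, $U_S^{\mathrm{MT}}$ pro-unipotent. $\mathrm{Lie}(U_S^{\mathrm{MT}})$ is graded by half-weight (in degrees $\le-1$) and is free pro-nilpotent; free homogeneous generators are obtained by lifting bases of $\mathrm{Lie}(U_S^{\mathrm{MT}})^{\mathrm{ab}}_{-n}\cong\mathrm{Ext}^1_{\mathrm{MT}(\mathcal O_{K,S},\mathbb Q)}(\mathbb Q(0),\mathbb Q(n))^\vee$, of dimension $d_n$. Fix such generators: $\tau_1,\dots,\tau_{d_1}$ in degree $-1$ and $\sigma_{n,1},\dots,\sigma_{n,d_n}$ in degree $-n$ for $n\ge2$. **Polylogarithmic Lie algebra.** $\mathrm{Lie}(\Pi_{\mathrm{PL}}^\omega)$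 is the quotient of the free pro-nilpotent Lie algebra on two generators $e_0,e_1$ (of degree $-1$) by all Lie monomials of $e_1$-degree $>1$; it has basis $e_0$, and $\mathrm{ad}(e_0)^{n-1}e_1$ (degree $-n$) for $n\ge1$. $\mathrm{Lie}(\Pi_{\mathrm{PL},N}^\omega)$ is the quotient by all $\mathrm{ad}(e_0)^{n-1}e_1$ with $n>N$. $\mathrm{Hom}_{\mathrm{gr}}$ denotes graded Lie algebra homomorphisms (the functor of such over $\mathbb Q$-algebras). **Goncharov coefficients.** The Goncharov ideal is $I_{\mathrm{Gon}}=[\mathrm{Lie}(U_S^{\mathrm{MT}})_{\le-2},\mathrm{Lie}(U_S^{\mathrm{MT}})_{\le-2}]$. Every $\varepsilon\in\mathrm{Lie}(U_S^{\mathrm{MT}})(R)$ can be written uniquely as $\varepsilon=\sum_{n\ge1}\varepsilon_n+\varepsilon_{\mathrm{Gon}}$ with $\varepsilon_{\mathrm{Gon}}$ in the Goncharov ideal, $\varepsilon_1=\sum_{i=1}^{d_1}c_{\tau_i}\tau_i$, and for $n\ge2$ $$\varepsilon_n=\sum_{i_1\le\dots\le i_{n-1}>i_n}c_{\tau_{i_1}\cdots\tau_{i_n}}\mathrm{ad}(\tau_{i_1})\cdots\mathrm{ad}(\tau_{i_{n-1}})\tau_{i_n}+\sum_{m=2}^n\sum_{i=1}^{d_m}\sum_{i_1\le\dots\le i_{n-m}}c_{\tau_{i_1}\cdots\tau_{i_{n-m}}\sigma_{m,i}}\mathrm{ad}(\tau_{i_1})\cdots\mathrm{ad}(\tau_{i_{n-m}})\sigma_{m,i},$$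 with $c_w\in R$ and all $i_j\in\{1,\dots,d_1\}$. The $c_w$ are the Goncharov coefficients of $\varepsilon$. *)

theory Defs
  imports "HOL-Algebra.QuotRing" "HOL-Algebra.Module" "HOL-Library.Extended_Nat"
begin

text \<open>
  Commutative unital algebras over the rationals. The base class is not \<^class>\<open>comm_ring_1\<close>,
  because that class excludes the zero algebra.
\<close>

class rat_algebra = comm_ring + comm_monoid_mult +
  fixes scaleQ :: "rat \<Rightarrow> 'a \<Rightarrow> 'a"
  assumes scaleQ_add_right: "scaleQ q (a + b) = scaleQ q a + scaleQ q b"
    and scaleQ_add_left: "scaleQ (p + q) a = scaleQ p a + scaleQ q a"
    and scaleQ_scaleQ: "scaleQ p (scaleQ q a) = scaleQ (p * q) a"
    and scaleQ_one: "scaleQ 1 a = a"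
    and scaleQ_mult_left: "scaleQ q a * b = scaleQ q (a * b)"

section \<open>Graded pro-nilpotent Lie algebras\<close>

text \<open>
  Lie algebras have an explicit carrier; the scalars form a type. The multiplication of the
  underlying \<^type>\<open>ring\<close> record is the Lie bracket, and the record field \<open>one\<close> has no meaning.
  All degrees in the mathematics are negative; \<open>component L n\<close> is the projection to the part of
  degree \<open>-n\<close>.
\<close>

record ('r, 'l) graded_lie = "('r, 'l) module" +
  component :: "nat \<Rightarrow> 'l \<Rightarrow> 'l"

text \<open>
  A graded pro-nilpotent Lie algebra in degrees at most \<open>-1\<close> is the product, not the direct sum, of
  its graded pieces (\<open>complete\<close>).
\<close>

locale pronilpotent_graded_lie = abelian_group L
  for L :: "('r::rat_algebra, 'l) graded_lie" (structure) +
  assumes smult_closed: "a \<in> carrier L \<Longrightarrow> r \<odot> a \<in> carrier L"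
    and smult_add_left: "a \<in> carrier L \<Longrightarrow> (r + s) \<odot> a = r \<odot> a \<oplus> s \<odot> a"
    and smult_add_right: "\<lbrakk>a \<in> carrier L; b \<in> carrier L\<rbrakk> \<Longrightarrow> r \<odot> (a \<oplus> b) = r \<odot> a \<oplus> r \<odot> b"
    and smult_smult: "a \<in> carrier L \<Longrightarrow> r \<odot> (s \<odot> a) = (r * s) \<odot> a"
    and smult_one: "a \<in> carrier L \<Longrightarrow> 1 \<odot> a = a"
    and bracket_closed: "\<lbrakk>a \<in> carrier L; b \<in> carrier L\<rbrakk> \<Longrightarrow> a \<otimes> b \<in> carrier L"
    and bracket_add_left: "\<lbrakk>a \<in> carrier L; b \<in> carrier L; c \<in> carrier L\<rbrakk>
      \<Longrightarrow> (a \<oplus> b) \<otimes> c = a \<otimes> c \<oplus> b \<otimes> c"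
    and bracket_add_right: "\<lbrakk>a \<in> carrier L; b \<in> carrier L; c \<in> carrier L\<rbrakk>
      \<Longrightarrow> a \<otimes> (b \<oplus> c) = a \<otimes> b \<oplus> a \<otimes> c"
    and bracket_smult_left: "\<lbrakk>a \<in> carrier L; b \<in> carrier L\<rbrakk> \<Longrightarrow> (r \<odot> a) \<otimes> b = r \<odot> (a \<otimes> b)"
    and bracket_smult_right: "\<lbrakk>a \<in> carrier L; b \<in> carrier L\<rbrakk> \<Longrightarrow> a \<otimes> (r \<odot> b) = r \<odot> (a \<otimes> b)"
    and bracket_self: "a \<in> carrier L \<Longrightarrow> a \<otimes> a = \<zero>"
    and jacobi: "\<lbrakk>a \<in> carrier L; b \<in> carrier L; c \<in> carrier L\<rbrakk>
      \<Longrightarrow> a \<otimes> (b \<otimes> c) \<oplus> b \<otimes> (c \<otimes> a) \<oplus> c \<otimes> (a \<otimes> b) = \<zero>"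
    and component_closed: "a \<in> carrier L \<Longrightarrow> component L n a \<in> carrier L"
    and component_add: "\<lbrakk>a \<in> carrier L; b \<in> carrier L\<rbrakk>
      \<Longrightarrow> component L n (a \<oplus> b) = component L n a \<oplus> component L n b"
    and component_smult: "a \<in> carrier L \<Longrightarrow> component L n (r \<odot> a) = r \<odot> component L n a"
    and component_component: "a \<in> carrier L
      \<Longrightarrow> component L m (component L n a) = (if m = n then component L n a else \<zero>)"
    and component_zero: "a \<in> carrier L \<Longrightarrow> component L 0 a = \<zero>"
    and component_bracket: "\<lbrakk>a \<in> carrier L; b \<in> carrier L\<rbrakk>
      \<Longrightarrow> component L n (a \<otimes> b) = (\<Oplus>i\<in>{..n}. component L i a \<otimes> component L (n - i) b)"
    and complete: "\<lbrakk>\<And>n. f n \<in> carrier L; f 0 = \<zero>; \<And>n. component L n (f n) = f n\<rbrakk>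
      \<Longrightarrow> \<exists>!a. a \<in> carrier L \<and> (\<forall>n. component L n a = f n)"

text \<open>
  The sum of the homogeneous elements \<open>f n\<close> of degree \<open>-n\<close> over all \<open>n \<in> A\<close>, possibly infinite.
\<close>

definition homogeneous_sum :: "('r, 'l) graded_lie \<Rightarrow> nat set \<Rightarrow> (nat \<Rightarrow> 'l) \<Rightarrow> 'l" where
  "homogeneous_sum L A f =
    (THE s. s \<in> carrier L \<and> (\<forall>n. component L n s = (if n \<in> A then f n else \<zero>\<^bsub>L\<^esub>)))"

text \<open>
  Commuting with all the projections, rather than only mapping graded pieces to graded pieces, says
  that a homomorphism of products of graded pieces is the product of its graded parts. This
  includes continuity.
\<close>

definition hom_gr :: "('r, 'l) graded_lie \<Rightarrow> ('r, 'm) graded_lie \<Rightarrow> ('l \<Rightarrow> 'm) set" where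
  "hom_gr L M = {\<xi>. \<xi> \<in> carrier L \<rightarrow> carrier M
    \<and> (\<forall>a\<in>carrier L. \<forall>b\<in>carrier L. \<xi> (a \<oplus>\<^bsub>L\<^esub> b) = \<xi> a \<oplus>\<^bsub>M\<^esub> \<xi> b)
    \<and> (\<forall>r. \<forall>a\<in>carrier L. \<xi> (r \<odot>\<^bsub>L\<^esub> a) = r \<odot>\<^bsub>M\<^esub> \<xi> a)
    \<and> (\<forall>a\<in>carrier L. \<forall>b\<in>carrier L. \<xi> (a \<otimes>\<^bsub>L\<^esub> b) = \<xi> a \<otimes>\<^bsub>M\<^esub> \<xi> b)
    \<and> (\<forall>n. \<forall>a\<in>carrier L. \<xi> (component L n a) = component M n (\<xi> a))}"

definition cocycle_eval :: "'l \<Rightarrow> ('l \<Rightarrow> 'm) \<Rightarrow> 'm" where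
  "cocycle_eval \<epsilon> \<xi> = \<xi> \<epsilon>"

definition ad :: "('r, 'l) graded_lie \<Rightarrow> 'l \<Rightarrow> 'l \<Rightarrow> 'l" where
  "ad L a b = a \<otimes>\<^bsub>L\<^esub> b"

text \<open>The closure in the topology defined by the filtration by degree.\<close>

definition degree_closure :: "('r, 'l) graded_lie \<Rightarrow> 'l set \<Rightarrow> 'l set" where
  "degree_closure L V =
    {a \<in> carrier L. \<forall>n. \<exists>v\<in>V. \<forall>k\<le>n. component L k a = component L k v}"

inductive_set submodule_span :: "('r, 'l) graded_lie \<Rightarrow> 'l set \<Rightarrow> 'l set"
  for L :: "('r, 'l) graded_lie" and B :: "'l set" where
  zero: "\<zero>\<^bsub>L\<^esub> \<in> submodule_span L B"
| base: "b \<in> B \<Longrightarrow> b \<in> submodule_span L B"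
| add: "a \<in> submodule_span L B \<Longrightarrow> b \<in> submodule_span L B \<Longrightarrow> a \<oplus>\<^bsub>L\<^esub> b \<in> submodule_span L B"
| smult: "a \<in> submodule_span L B \<Longrightarrow> r \<odot>\<^bsub>L\<^esub> a \<in> submodule_span L B"

inductive_set lie_subalgebra_span :: "('r, 'l) graded_lie \<Rightarrow> 'l set \<Rightarrow> 'l set"
  for L :: "('r, 'l) graded_lie" and B :: "'l set" where
  zero: "\<zero>\<^bsub>L\<^esub> \<in> lie_subalgebra_span L B"
| base: "b \<in> B \<Longrightarrow> b \<in> lie_subalgebra_span L B"
| add: "a \<in> lie_subalgebra_span L B \<Longrightarrow> b \<in> lie_subalgebra_span L B
    \<Longrightarrow> a \<oplus>\<^bsub>L\<^esub> b \<in> lie_subalgebra_span L B"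
| smult: "a \<in> lie_subalgebra_span L B \<Longrightarrow> r \<odot>\<^bsub>L\<^esub> a \<in> lie_subalgebra_span L B"
| bracket: "a \<in> lie_subalgebra_span L B \<Longrightarrow> b \<in> lie_subalgebra_span L B
    \<Longrightarrow> a \<otimes>\<^bsub>L\<^esub> b \<in> lie_subalgebra_span L B"

inductive_set lie_ideal_span :: "('r, 'l) graded_lie \<Rightarrow> 'l set \<Rightarrow> 'l set"
  for L :: "('r, 'l) graded_lie" and B :: "'l set" where
  zero: "\<zero>\<^bsub>L\<^esub> \<in> lie_ideal_span L B"
| base: "b \<in> B \<Longrightarrow> b \<in> lie_ideal_span L B"
| add: "a \<in> lie_ideal_span L B \<Longrightarrow> b \<in> lie_ideal_span L B \<Longrightarrow> a \<oplus>\<^bsub>L\<^esub> b \<in> lie_ideal_span L B"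
| smult: "a \<in> lie_ideal_span L B \<Longrightarrow> r \<odot>\<^bsub>L\<^esub> a \<in> lie_ideal_span L B"
| bracket: "a \<in> carrier L \<Longrightarrow> b \<in> lie_ideal_span L B \<Longrightarrow> a \<otimes>\<^bsub>L\<^esub> b \<in> lie_ideal_span L B"

text \<open>
  The quotient by a closed ideal generated by homogeneous elements. The first five fields are those
  of \<^term>\<open>L Quot I\<close>.
\<close>

definition lie_quotient :: "('r, 'l) graded_lie \<Rightarrow> 'l set \<Rightarrow> ('r, 'l set) graded_lie" where
  "lie_quotient L I =
    \<lparr>carrier = a_rcosets\<^bsub>L\<^esub> I, mult = rcoset_mult L I, one = I +>\<^bsub>L\<^esub> \<one>\<^bsub>L\<^esub>, zero = I, add = set_add L,
     smult = (\<lambda>r A. \<Union>a\<in>A. I +>\<^bsub>L\<^esub> (r \<odot>\<^bsub>L\<^esub> a)),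
     component = (\<lambda>n A. \<Union>a\<in>A. I +>\<^bsub>L\<^esub> component L n a)\<rparr>"

section \<open>Free pro-nilpotent Lie algebras\<close>

text \<open>
  Noncommutative formal power series in letters \<open>x :: 'a\<close> of degree \<open>-wt x\<close>, as functions on words,
  with the commutator of the convolution product as bracket. By the theorem of Witt, the Lie
  subalgebra generated by the letters is the free Lie algebra; its closure consists of the series
  whose homogeneous components are Lie polynomials. In each degree the Lie polynomials
  over \<open>'r\<close> are the base change to \<open>'r\<close> of the rational ones, so \<open>free_lie\<close> over \<open>'r\<close> is the Lie
  algebra of \<open>'r\<close>-points of the free pro-nilpotent Lie algebra over the rationals.
\<close>

definition word_weight :: "('a \<Rightarrow> nat) \<Rightarrow> 'a list \<Rightarrow> nat" where
  "word_weight wt w = sum_list (map wt w)"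

definition series_mult ::
  "('a list \<Rightarrow> 'r::rat_algebra) \<Rightarrow> ('a list \<Rightarrow> 'r) \<Rightarrow> 'a list \<Rightarrow> 'r" where
  "series_mult f g = (\<lambda>w. \<Sum>k\<le>length w. f (take k w) * g (drop k w))"

definition series_lie :: "('a \<Rightarrow> nat) \<Rightarrow> ('r::rat_algebra, 'a list \<Rightarrow> 'r) graded_lie" where
  "series_lie wt =
    \<lparr>carrier = UNIV, mult = (\<lambda>f g w. series_mult f g w - series_mult g f w), one = undefined,
     zero = (\<lambda>w. 0), add = (\<lambda>f g w. f w + g w), smult = (\<lambda>r f w. r * f w),
     component = (\<lambda>n f w. if word_weight wt w = n then f w else 0)\<rparr>"

definition letter :: "'a \<Rightarrow> 'a list \<Rightarrow> 'r::rat_algebra" where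
  "letter x = (\<lambda>w. if w = [x] then 1 else 0)"

definition free_lie ::
  "('a \<Rightarrow> nat) \<Rightarrow> 'a set \<Rightarrow> ('r::rat_algebra, 'a list \<Rightarrow> 'r) graded_lie" where
  "free_lie wt X = (series_lie wt)\<lparr>carrier :=
    degree_closure (series_lie wt) (lie_subalgebra_span (series_lie wt) (letter ` X))\<rparr>"

text \<open>
  The letters for free generators of \<open>Lie(U\<^sub>S\<^sup>M\<^sup>T)\<close>: \<open>Tau i\<close> for \<open>1 \<le> i \<le> d 1\<close> in degree
  \<open>-1\<close>, and \<open>Sig n i\<close> for \<open>n \<ge> 2\<close> and \<open>1 \<le> i \<le> d n\<close> in degree \<open>-n\<close>.
\<close>

datatype mt_letter = Tau nat | Sig nat nat

fun mt_weight :: "mt_letter \<Rightarrow> nat" where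
  "mt_weight (Tau i) = 1"
| "mt_weight (Sig n i) = n"

definition mt_letters :: "(nat \<Rightarrow> nat) \<Rightarrow> mt_letter set" where
  "mt_letters d = {Tau i |i. i \<in> {1..d 1}} \<union> {Sig n i |n i. 2 \<le> n \<and> i \<in> {1..d n}}"

text \<open>
  The Lie algebra of \<open>'r\<close>-points of \<open>U\<^sub>S\<^sup>M\<^sup>T\<close> enters as a graded pro-nilpotent Lie algebra \<open>L\<close>
  together with a choice of free homogeneous generators; such a choice is the same as a graded
  isomorphism from the free pro-nilpotent Lie algebra on the letters.
\<close>

definition free_on_generators :: "('r::rat_algebra, 'u) graded_lie \<Rightarrow> (nat \<Rightarrow> nat)
    \<Rightarrow> (nat \<Rightarrow> 'u) \<Rightarrow> (nat \<Rightarrow> nat \<Rightarrow> 'u) \<Rightarrow> bool" where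
  "free_on_generators L d \<tau> \<sigma> \<longleftrightarrow>
    (\<exists>\<phi>\<in>hom_gr (free_lie mt_weight (mt_letters d)) L.
      bij_betw \<phi> (carrier (free_lie mt_weight (mt_letters d))) (carrier L)
      \<and> (\<forall>i\<in>{1..d 1}. \<phi> (letter (Tau i)) = \<tau> i)
      \<and> (\<forall>n\<ge>2. \<forall>i\<in>{1..d n}. \<phi> (letter (Sig n i)) = \<sigma> n i))"

section \<open>The polylogarithmic Lie algebra\<close>

datatype pl_letter = E0 | E1

definition pl_free :: "('r::rat_algebra, pl_letter list \<Rightarrow> 'r) graded_lie" where
  "pl_free = free_lie (\<lambda>_. 1) {E0, E1}"

text \<open>Lie monomials in \<open>e\<^sub>0\<close> and \<open>e\<^sub>1\<close> of the given \<open>e\<^sub>1\<close>-degree.\<close>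

inductive pl_monomial :: "nat \<Rightarrow> (pl_letter list \<Rightarrow> 'r::rat_algebra) \<Rightarrow> bool" where
  "pl_monomial 0 (letter E0)"
| "pl_monomial 1 (letter E1)"
| "pl_monomial p f \<Longrightarrow> pl_monomial q g \<Longrightarrow> pl_monomial (p + q) (f \<otimes>\<^bsub>pl_free\<^esub> g)"

definition pl_ideal :: "enat \<Rightarrow> (pl_letter list \<Rightarrow> 'r::rat_algebra) set" where
  "pl_ideal N = degree_closure pl_free (lie_ideal_span pl_free
    ({f. \<exists>p>1. pl_monomial p f}
     \<union> {(ad pl_free (letter E0) ^^ (n - 1)) (letter E1) |n. 1 \<le> n \<and> N < enat n}))"

text \<open>The case \<open>N = \<infinity>\<close> is the polylogarithmic Lie algebra itself.\<close>

definition PL :: "enat \<Rightarrow> ('r::rat_algebra, (pl_letter list \<Rightarrow> 'r) set) graded_lie" where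
  "PL N = lie_quotient pl_free (pl_ideal N)"

definition e0 :: "enat \<Rightarrow> (pl_letter list \<Rightarrow> 'r::rat_algebra) set" where
  "e0 N = pl_ideal N +>\<^bsub>pl_free\<^esub> letter E0"

definition e1 :: "enat \<Rightarrow> (pl_letter list \<Rightarrow> 'r::rat_algebra) set" where
  "e1 N = pl_ideal N +>\<^bsub>pl_free\<^esub> letter E1"

section \<open>Goncharov coefficients\<close>

definition degree_le_minus_2 :: "('r, 'l) graded_lie \<Rightarrow> 'l set" where
  "degree_le_minus_2 L = {a \<in> carrier L. \<forall>n<2. component L n a = \<zero>\<^bsub>L\<^esub>}"

definition goncharov_ideal :: "('r, 'l) graded_lie \<Rightarrow> 'l set" where
  "goncharov_ideal L = degree_closure L (submodule_span L
    {a \<otimes>\<^bsub>L\<^esub> b |a b. a \<in> degree_le_minus_2 L \<and> b \<in> degree_le_minus_2 L})"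

text \<open>The index tuples \<open>i\<^sub>1 \<le> \<dots> \<le> i\<^sub>p\<close> with entries in \<open>{1..D}\<close>.\<close>

definition sorted_tuples :: "nat \<Rightarrow> nat \<Rightarrow> nat list set" where
  "sorted_tuples p D = {u. length u = p \<and> sorted u \<and> set u \<subseteq> {1..D}}"

text \<open>
  The component \<open>\<epsilon>\<^sub>n\<close> determined by a family \<open>c\<close> of coefficients indexed by words in the generators.
  In the first sum for \<open>n \<ge> 2\<close>, \<open>u\<close> is \<open>(i\<^sub>1, \<dots>, i\<^bsub>n-1\<^esub>)\<close> and \<open>j\<close> is \<open>i\<^sub>n\<close>.
\<close>

definition goncharov_term :: "('r::rat_algebra, 'u) graded_lie \<Rightarrow> (nat \<Rightarrow> nat)
    \<Rightarrow> (nat \<Rightarrow> 'u) \<Rightarrow> (nat \<Rightarrow> nat \<Rightarrow> 'u) \<Rightarrow> (mt_letter list \<Rightarrow> 'r) \<Rightarrow> nat \<Rightarrow> 'u" where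
  "goncharov_term L d \<tau> \<sigma> c n =
    (if n = 1 then \<Oplus>\<^bsub>L\<^esub>i\<in>{1..d 1}. c [Tau i] \<odot>\<^bsub>L\<^esub> \<tau> i
     else
       (\<Oplus>\<^bsub>L\<^esub>u\<in>sorted_tuples (n - 1) (d 1). \<Oplus>\<^bsub>L\<^esub>j\<in>{j\<in>{1..d 1}. j < last u}.
          c (map Tau (u @ [j])) \<odot>\<^bsub>L\<^esub> foldr (\<lambda>i. ad L (\<tau> i)) u (\<tau> j))
       \<oplus>\<^bsub>L\<^esub>
       (\<Oplus>\<^bsub>L\<^esub>m\<in>{2..n}. \<Oplus>\<^bsub>L\<^esub>i\<in>{1..d m}. \<Oplus>\<^bsub>L\<^esub>u\<in>sorted_tuples (n - m) (d 1).
          c (map Tau u @ [Sig m i]) \<odot>\<^bsub>L\<^esub> foldr (\<lambda>i. ad L (\<tau> i)) u (\<sigma> m i)))"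

definition goncharov_coefficients :: "('r::rat_algebra, 'u) graded_lie \<Rightarrow> (nat \<Rightarrow> nat)
    \<Rightarrow> (nat \<Rightarrow> 'u) \<Rightarrow> (nat \<Rightarrow> nat \<Rightarrow> 'u) \<Rightarrow> 'u \<Rightarrow> (mt_letter list \<Rightarrow> 'r) \<Rightarrow> bool" where
  "goncharov_coefficients L d \<tau> \<sigma> \<epsilon> c \<longleftrightarrow>
    (\<exists>\<gamma>\<in>goncharov_ideal L. \<epsilon> = homogeneous_sum L {1..} (goncharov_term L d \<tau> \<sigma> c) \<oplus>\<^bsub>L\<^esub> \<gamma>)"

text \<open>
  The coefficient \<open>c'\<close> of the word with indices \<open>u = (i\<^sub>1, \<dots>, i\<^bsub>n-1\<^esub>)\<close> and \<open>j = i\<^sub>n\<close>. As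
  \<open>i < j\<close> in the sum, \<open>remove1 i\<close> only affects \<open>u\<close>.
\<close>

definition goncharov_c' :: "(mt_letter list \<Rightarrow> 'r::rat_algebra) \<Rightarrow> nat list \<Rightarrow> nat \<Rightarrow> 'r" where
  "goncharov_c' c u j =
    (if j < last u then c (map Tau (u @ [j]))
     else - (\<Sum>i\<in>{i\<in>set u. i < j}. c (map Tau (remove1 i (u @ [j]) @ [i]))))"

end

theory Submission
  imports Defs "HOL-Library.Function_Algebras"
begin

text \<open>
  In the polylogarithmic Lie algebra any two elements without \<open>e\<^sub>0\<close>-part commute, because a Lie
  polynomial without \<open>e\<^sub>0\<close>-part is a combination of Lie monomials of positive \<open>e\<^sub>1\<close>-degree. Hence a
  graded homomorphism \<open>\<xi>\<close> kills the Goncharov ideal, and it is determined on \<open>\<epsilon>\<close> by its values on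
  the homogeneous terms \<open>\<epsilon>\<^sub>n\<close>. There \<open>ad (\<tau>\<^sub>i)\<close> acts on multiples of \<open>ad (e\<^sub>0)\<^bsup>m-1\<^esup> e\<^sub>1\<close> as \<open>x\<^sub>i ad (e\<^sub>0)\<close>,
  and the innermost bracket of a word in the \<open>\<tau>\<^sub>i\<close> gives \<open>[\<tau>\<^sub>i, \<tau>\<^sub>j] \<mapsto> (x\<^sub>i y\<^sub>j - x\<^sub>j y\<^sub>i) [e\<^sub>0, e\<^sub>1]\<close>.
  Collecting the coefficients of the monomials in \<open>x\<close> and \<open>y\<close> produces \<open>c'\<close>.

  The quotient is handled through representatives: all computations take place among series,
  modulo the closed ideal.
\<close>

declare One_nat_def [simp del]

section \<open>Series\<close>

text \<open>Scaling, bracket and projection of \<open>series_lie\<close> get names; addition and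
  zero are the pointwise ones of the function type, so that series form an additive group and its
  algebra applies directly.\<close>

definition series_scale :: "'r::rat_algebra \<Rightarrow> ('a list \<Rightarrow> 'r) \<Rightarrow> 'a list \<Rightarrow> 'r" where
  "series_scale r f = (\<lambda>w. r * f w)"

definition series_bracket ::
  "('a list \<Rightarrow> 'r::rat_algebra) \<Rightarrow> ('a list \<Rightarrow> 'r) \<Rightarrow> 'a list \<Rightarrow> 'r" where
  "series_bracket f g = (\<lambda>w. series_mult f g w - series_mult g f w)"

definition series_part ::
  "('a \<Rightarrow> nat) \<Rightarrow> nat \<Rightarrow> ('a list \<Rightarrow> 'r::rat_algebra) \<Rightarrow> 'a list \<Rightarrow> 'r" where
  "series_part wt n f = (\<lambda>w. if word_weight wt w = n then f w else 0)"

text \<open>Congruence modulo series of weight above \<open>n\<close>: the basic neighbourhoods of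
  the degree topology.\<close>

definition agree_upto ::
  "('a \<Rightarrow> nat) \<Rightarrow> nat \<Rightarrow> ('a list \<Rightarrow> 'r::rat_algebra) \<Rightarrow> ('a list \<Rightarrow> 'r) \<Rightarrow> bool" where
  "agree_upto wt n f g \<longleftrightarrow> (\<forall>w. word_weight wt w \<le> n \<longrightarrow> f w = g w)"

lemma series_lie_simps [simp]:
  "carrier (series_lie wt) = UNIV"
  "zero (series_lie wt) = 0"
  "add (series_lie wt) = (+)"
  "mult (series_lie wt) = series_bracket"
  "smult (series_lie wt) = series_scale"
  "component (series_lie wt) = series_part wt"
  by (simp_all add: series_lie_def series_scale_def series_bracket_def series_part_def
      zero_fun_def plus_fun_def fun_eq_iff)

lemma free_lie_simps [simp]:
  "zero (free_lie wt X) = 0"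
  "add (free_lie wt X) = (+)"
  "mult (free_lie wt X) = series_bracket"
  "smult (free_lie wt X) = series_scale"
  "component (free_lie wt X) = series_part wt"
  using series_lie_simps[of wt] by (simp_all add: free_lie_def)

section \<open>Linear algebra of the commutator bracket\<close>

lemma series_bracket_add_left:
  "series_bracket (f + g) h = series_bracket f h + series_bracket g h"
  by (simp add: series_bracket_def series_mult_def fun_eq_iff algebra_simps sum.distrib)

lemma series_bracket_add_right:
  "series_bracket h (f + g) = series_bracket h f + series_bracket h g"
  by (simp add: series_bracket_def series_mult_def fun_eq_iff algebra_simps sum.distrib)

lemma series_bracket_scale_left:
  "series_bracket (series_scale r f) g = series_scale r (series_bracket f g)"
  by (simp add: series_bracket_def series_mult_def series_scale_def fun_eq_iff
      right_diff_distrib sum_distrib_left mult_ac)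

lemma series_bracket_scale_right:
  "series_bracket f (series_scale r g) = series_scale r (series_bracket f g)"
  by (simp add: series_bracket_def series_mult_def series_scale_def fun_eq_iff
      right_diff_distrib sum_distrib_left mult_ac)

lemma series_bracket_self [simp]: "series_bracket f f = 0"
  by (simp add: series_bracket_def fun_eq_iff)

lemma series_bracket_zero [simp]: "series_bracket 0 f = 0" "series_bracket f 0 = 0"
  by (simp_all add: series_bracket_def series_mult_def fun_eq_iff)

lemma series_bracket_swap: "series_bracket g f = - series_bracket f g"
  by (simp add: series_bracket_def fun_eq_iff)

text \<open>Telescoping in one argument at a time; it reduces the independence of a bracket from the
  choice of representatives to the ideal property.\<close>

lemma series_bracket_diff:
  "series_bracket a b - series_bracket f g = series_bracket (a - f) b + series_bracket f (b - g)"
  by (simp add: series_bracket_def series_mult_def fun_eq_iff algebra_simps sum_subtractf)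

lemma series_scale_add_right: "series_scale r (f + g) = series_scale r f + series_scale r g"
  by (simp add: series_scale_def fun_eq_iff algebra_simps)

lemma series_scale_diff_right: "series_scale r (f - g) = series_scale r f - series_scale r g"
  by (simp add: series_scale_def fun_eq_iff algebra_simps)

lemma series_scale_add_left: "series_scale (r + s) f = series_scale r f + series_scale s f"
  by (simp add: series_scale_def fun_eq_iff algebra_simps)

lemma series_scale_scale: "series_scale r (series_scale s f) = series_scale (r * s) f"
  by (simp add: series_scale_def fun_eq_iff algebra_simps)

lemma series_scale_zero [simp]: "series_scale 0 f = 0" "series_scale r 0 = 0"
  by (simp_all add: series_scale_def fun_eq_iff)

lemma series_scale_minus_one: "series_scale (- 1) f = - f"
proof -
  \<comment> \<open>\<open>rat_algebra\<close> admits the zero algebra and hence is not a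
    \<open>ring_1\<close>, so this rule is derived from the ring and monoid laws.\<close>
  have "- 1 * a = - a" for a :: 'b
    using mult_minus_left[of 1 a] by simp
  then show ?thesis by (simp add: series_scale_def fun_eq_iff)
qed

section \<open>Projections to the graded pieces\<close>

lemma series_part_add: "series_part wt n (f + g) = series_part wt n f + series_part wt n g"
  by (simp add: series_part_def fun_eq_iff)

lemma series_part_diff: "series_part wt n (f - g) = series_part wt n f - series_part wt n g"
  by (simp add: series_part_def fun_eq_iff)

lemma series_part_scale: "series_part wt n (series_scale r f) = series_scale r (series_part wt n f)"
  by (simp add: series_part_def series_scale_def fun_eq_iff)

lemma series_part_zero [simp]: "series_part wt n 0 = 0"
  by (simp add: series_part_def fun_eq_iff)

lemma series_part_part:
  "series_part wt m (series_part wt n f) = (if m = n then series_part wt n f else 0)"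
  by (auto simp: series_part_def fun_eq_iff)

lemma series_part_letter:
  "series_part wt n (letter x) = (if wt x = n then letter x else 0)"
  by (auto simp: series_part_def letter_def word_weight_def fun_eq_iff)

lemma word_weight_take_drop: "word_weight wt (take k w) + word_weight wt (drop k w) = word_weight wt w"
  unfolding word_weight_def by (metis append_take_drop_id map_append sum_list_append)

lemma fun_sum_apply: "(\<Sum>i\<in>A. f i) w = (\<Sum>i\<in>A. (f i :: 'a \<Rightarrow> 'b::ab_group_add) w)"
  by (induction A rule: infinite_finite_induct) simp_all

lemma series_part_mult:
  "series_part wt n (series_mult f g) =
    (\<Sum>i\<le>n. series_mult (series_part wt i f) (series_part wt (n - i) g))"
proof
  fix w
  \<comment> \<open>For a fixed splitting of a word into \<open>u\<close> and \<open>v\<close>, only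
    the index \<open>i\<close> equal to the weight of \<open>u\<close> contributes, and then the
    weight of \<open>v\<close> must be \<open>n - i\<close>.\<close>
  have summand: "(\<Sum>i\<le>n. series_part wt i f u * series_part wt (n - i) g v) =
      (if word_weight wt u + word_weight wt v = n then f u * g v else 0)" for u v
  proof -
    have "(\<Sum>i\<le>n. series_part wt i f u * series_part wt (n - i) g v) =
        (\<Sum>i\<le>n. if word_weight wt u = i then f u * series_part wt (n - i) g v else 0)"
      by (rule sum.cong) (auto simp: series_part_def)
    also have "\<dots> = (if word_weight wt u + word_weight wt v = n then f u * g v else 0)"
      by (auto simp: series_part_def)
    finally show ?thesis .
  qed
  have "(\<Sum>i\<le>n. series_mult (series_part wt i f) (series_part wt (n - i) g)) w =
      (\<Sum>k\<le>length w. \<Sum>i\<le>n. series_part wt i f (take k w) * series_part wt (n - i) g (drop k w))"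
    unfolding fun_sum_apply series_mult_def by (rule sum.swap)
  also have "\<dots> = series_part wt n (series_mult f g) w"
    by (simp add: summand word_weight_take_drop) (simp add: series_part_def series_mult_def)
  finally show "series_part wt n (series_mult f g) w =
      (\<Sum>i\<le>n. series_mult (series_part wt i f) (series_part wt (n - i) g)) w" by simp
qed

lemma series_part_bracket:
  "series_part wt n (series_bracket f g) =
    (\<Sum>i\<le>n. series_bracket (series_part wt i f) (series_part wt (n - i) g))"
proof -
  have bracket: "series_bracket f g = series_mult f g - series_mult g f"
    for f g :: "'a list \<Rightarrow> 'b"
    by (simp add: series_bracket_def fun_eq_iff)
  \<comment> \<open>Reflecting the index in the reversed product makes both products run over the
    degree of \<open>f\<close>.\<close>
  have "(\<Sum>i\<le>n. series_mult (series_part wt i g) (series_part wt (n - i) f)) =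
      (\<Sum>i\<le>n. series_mult (series_part wt (n - i) g) (series_part wt i f))"
    by (rule sum.reindex_bij_witness[of _ "\<lambda>i. n - i" "\<lambda>i. n - i"]) auto
  then show ?thesis
    by (simp add: bracket series_part_diff series_part_mult sum_subtractf)
qed

section \<open>The topology given by the degree filtration\<close>

lemma agree_upto_iff_series_part:
  "agree_upto wt n f g \<longleftrightarrow> (\<forall>k\<le>n. series_part wt k f = series_part wt k g)"
  unfolding agree_upto_def series_part_def fun_eq_iff by metis

lemma agree_upto_mono: "agree_upto wt n f g \<Longrightarrow> m \<le> n \<Longrightarrow> agree_upto wt m f g"
  by (simp add: agree_upto_def)

lemma agree_upto_refl [simp]: "agree_upto wt n f f"
  by (simp add: agree_upto_def)

lemma agree_upto_add:
  "agree_upto wt n f f' \<Longrightarrow> agree_upto wt n g g' \<Longrightarrow> agree_upto wt n (f + g) (f' + g')"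
  by (simp add: agree_upto_def)

lemma agree_upto_scale:
  "agree_upto wt n f f' \<Longrightarrow> agree_upto wt n (series_scale r f) (series_scale r f')"
  by (simp add: agree_upto_def series_scale_def)

lemma agree_upto_part:
  "agree_upto wt n f f' \<Longrightarrow> agree_upto wt n (series_part wt k f) (series_part wt k f')"
  by (simp add: agree_upto_def series_part_def)

lemma agree_upto_sum_parts: "agree_upto wt n f (\<Sum>k\<le>n. series_part wt k f)"
  by (simp add: agree_upto_def fun_sum_apply series_part_def)

text \<open>A prefix or suffix weighs no more than the whole word, so truncation at weight
  \<open>n\<close> is compatible with products.\<close>

lemma agree_upto_bracket:
  assumes "agree_upto wt n f f'" "agree_upto wt n g g'"
  shows "agree_upto wt n (series_bracket f g) (series_bracket f' g')"
proof -
  have "series_mult f g w = series_mult f' g' w \<and> series_mult g f w = series_mult g' f' w"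
    if "word_weight wt w \<le> n" for w
  proof -
    have "word_weight wt (take k w) \<le> n" "word_weight wt (drop k w) \<le> n" for k
      using that word_weight_take_drop[of wt k w] by linarith+
    with assms show ?thesis by (simp add: agree_upto_def series_mult_def)
  qed
  then show ?thesis by (simp add: agree_upto_def series_bracket_def)
qed

text \<open>The density condition in \<open>degree_closure\<close>, separated from membership in the
  carrier so that the two can be handled independently.\<close>

definition approximable ::
  "('a \<Rightarrow> nat) \<Rightarrow> ('a list \<Rightarrow> 'r::rat_algebra) set \<Rightarrow> ('a list \<Rightarrow> 'r) \<Rightarrow> bool" where
  "approximable wt V f \<longleftrightarrow> (\<forall>n. \<exists>v\<in>V. agree_upto wt n f v)"

lemma approximableD:
  assumes "approximable wt V f"
  obtains v where "v \<in> V" "agree_upto wt n f v"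
  using assms by (auto simp: approximable_def)

lemma approximable_mem: "f \<in> V \<Longrightarrow> approximable wt V f"
  unfolding approximable_def using agree_upto_refl by blast

text \<open>Here \<open>g\<close> is the image of \<open>f\<close> under an operation
  \<open>h\<close> that is compatible with truncation and preserves \<open>V\<close>; such
  operations extend to the closure.\<close>

lemma approximable_map:
  assumes "approximable wt V f"
    and "\<And>n v. agree_upto wt n f v \<Longrightarrow> agree_upto wt n g (h v)"
    and "\<And>v. v \<in> V \<Longrightarrow> h v \<in> V"
  shows "approximable wt V g"
  unfolding approximable_def
proof
  fix n
  obtain v where "v \<in> V" "agree_upto wt n f v" using assms(1) by (rule approximableD)
  with assms(2,3) show "\<exists>v\<in>V. agree_upto wt n g v" by blast
qed

lemma approximable_add:
  assumes "approximable wt V f" "approximable wt V g" "\<And>v w. v \<in> V \<Longrightarrow> w \<in> V \<Longrightarrow> v + w \<in> V"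
  shows "approximable wt V (f + g)"
  unfolding approximable_def
proof
  fix n
  obtain v where v: "v \<in> V" "agree_upto wt n f v" using assms(1) by (rule approximableD)
  obtain w where w: "w \<in> V" "agree_upto wt n g w" using assms(2) by (rule approximableD)
  show "\<exists>v\<in>V. agree_upto wt n (f + g) v"
    using v w assms(3) agree_upto_add by blast
qed

lemma approximable_bracket:
  assumes "approximable wt A f" "approximable wt V g"
    and "\<And>v w. v \<in> A \<Longrightarrow> w \<in> V \<Longrightarrow> series_bracket v w \<in> V"
  shows "approximable wt V (series_bracket f g)"
  unfolding approximable_def
proof
  fix n
  obtain v where v: "v \<in> A" "agree_upto wt n f v" using assms(1) by (rule approximableD)
  obtain w where w: "w \<in> V" "agree_upto wt n g w" using assms(2) by (rule approximableD)
  show "\<exists>v\<in>V. agree_upto wt n (series_bracket f g) v"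
    using v w assms(3) agree_upto_bracket by blast
qed

lemma degree_closure_iff:
  assumes "component L = series_part wt"
  shows "f \<in> degree_closure L V \<longleftrightarrow> f \<in> carrier L \<and> approximable wt V f"
  by (simp add: degree_closure_def approximable_def agree_upto_iff_series_part assms)

section \<open>Free pro-nilpotent Lie algebras\<close>

abbreviation lie_polys :: "('a \<Rightarrow> nat) \<Rightarrow> 'a set \<Rightarrow> ('a list \<Rightarrow> 'r::rat_algebra) set" where
  "lie_polys wt X \<equiv> lie_subalgebra_span (series_lie wt) (letter ` X)"

lemma lie_polys_closed:
  "0 \<in> lie_polys wt X"
  "f \<in> lie_polys wt X \<Longrightarrow> g \<in> lie_polys wt X \<Longrightarrow> f + g \<in> lie_polys wt X"
  "f \<in> lie_polys wt X \<Longrightarrow> series_scale r f \<in> lie_polys wt X"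
  "f \<in> lie_polys wt X \<Longrightarrow> g \<in> lie_polys wt X \<Longrightarrow> series_bracket f g \<in> lie_polys wt X"
  using lie_subalgebra_span.intros[where L = "series_lie wt" and B = "letter ` X"] by simp_all

lemma sum_in_closed:
  assumes "0 \<in> V" "\<And>f g. f \<in> V \<Longrightarrow> g \<in> V \<Longrightarrow> f + g \<in> V" "\<And>i. i \<in> A \<Longrightarrow> h i \<in> V"
  shows "(\<Sum>i\<in>A. h i) \<in> V"
  using assms(3) by (induction A rule: infinite_finite_induct) (simp_all add: assms(1,2))

text \<open>The letters are homogeneous and the bracket adds degrees, so each generator and each
  operation of the span respects the grading.\<close>

lemma lie_polys_part:
  assumes "f \<in> lie_polys wt X"
  shows "series_part wt n f \<in> lie_polys wt X"
  using assms
proof (induction arbitrary: n rule: lie_subalgebra_span.induct)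
  case (base b)
  then show ?case
    using lie_subalgebra_span.base[of b "letter ` X" "series_lie wt"]
    by (auto simp: series_part_letter lie_polys_closed)
next
  case (bracket a b)
  then show ?case
    by (simp only: series_lie_simps series_part_bracket)
      (intro sum_in_closed lie_polys_closed)
qed (simp_all add: series_part_add series_part_scale lie_polys_closed)

lemma carrier_free_lie:
  "f \<in> carrier (free_lie wt X) \<longleftrightarrow> approximable wt (lie_polys wt X) f"
  by (simp add: free_lie_def degree_closure_iff[OF series_lie_simps(6)])

lemma lie_polys_subset: "lie_polys wt X \<subseteq> carrier (free_lie wt X)"
  by (auto simp: carrier_free_lie approximable_mem)

lemma free_lie_letter: "x \<in> X \<Longrightarrow> letter x \<in> carrier (free_lie wt X)"
  by (rule subsetD[OF lie_polys_subset], rule lie_subalgebra_span.base) simp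

text \<open>Each operation is compatible with truncation and preserves Lie polynomials, so it passes
  to the closure.\<close>

lemma free_lie_closed:
  fixes f g :: "'a list \<Rightarrow> 'r::rat_algebra" and wt :: "'a \<Rightarrow> nat" and X :: "'a set"
  defines "C \<equiv> carrier (free_lie wt X) :: ('a list \<Rightarrow> 'r) set"
  shows "0 \<in> C"
    and "f \<in> C \<Longrightarrow> g \<in> C \<Longrightarrow> f + g \<in> C"
    and "f \<in> C \<Longrightarrow> series_scale r f \<in> C"
    and "f \<in> C \<Longrightarrow> g \<in> C \<Longrightarrow> series_bracket f g \<in> C"
    and "f \<in> C \<Longrightarrow> series_part wt n f \<in> C"
  unfolding C_def carrier_free_lie
proof -
  let ?P = "approximable wt (lie_polys wt X) :: ('a list \<Rightarrow> 'r) \<Rightarrow> bool"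
  show "?P 0"
    by (rule approximable_mem) (rule lie_polys_closed)
  show "?P (f + g)" if "?P f" "?P g"
    using that by (rule approximable_add) (rule lie_polys_closed)
  show "?P (series_scale r f)" if "?P f"
    using that by (rule approximable_map[OF _ agree_upto_scale lie_polys_closed(3)])
  show "?P (series_bracket f g)" if "?P f" "?P g"
    using that by (rule approximable_bracket) (rule lie_polys_closed)
  show "?P (series_part wt n f)" if "?P f"
    using that by (rule approximable_map[OF _ agree_upto_part lie_polys_part])
qed

lemma free_lie_diff:
  "f \<in> carrier (free_lie wt X) \<Longrightarrow> g \<in> carrier (free_lie wt X) \<Longrightarrow> f - g \<in> carrier (free_lie wt X)"
proof -
  assume f: "f \<in> carrier (free_lie wt X)" and g: "g \<in> carrier (free_lie wt X)"
  have "f - g = f + series_scale (- 1) g"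
    unfolding series_scale_minus_one by (rule diff_conv_add_uminus)
  then show ?thesis
    using free_lie_closed(2)[OF f free_lie_closed(3)[OF g, of "- 1"]] by (simp only:)
qed

section \<open>The polylogarithmic quotient\<close>

abbreviation pl_part :: "nat \<Rightarrow> (pl_letter list \<Rightarrow> 'r::rat_algebra) \<Rightarrow> pl_letter list \<Rightarrow> 'r" where
  "pl_part \<equiv> series_part (\<lambda>_. 1)"

lemma pl_word_weight: "word_weight (\<lambda>_. 1) w = length w"
  by (simp add: word_weight_def sum_list_triv)

lemma pl_free_simps [simp]:
  "zero pl_free = 0"
  "add pl_free = (+)"
  "mult pl_free = series_bracket"
  "smult pl_free = series_scale"
  "component pl_free = pl_part"
  by (simp_all add: pl_free_def)

lemma pl_free_letter [simp]: "letter s \<in> carrier pl_free"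
  unfolding pl_free_def by (rule free_lie_letter) (cases s; simp)

lemmas pl_free_closed =
  free_lie_closed[where wt = "\<lambda>_. 1" and X = "{E0, E1}", folded pl_free_def]
  free_lie_diff[where wt = "\<lambda>_. 1" and X = "{E0, E1}", folded pl_free_def]

lemma pl_free_agree:
  assumes "f \<in> carrier pl_free"
  obtains v where "v \<in> lie_polys (\<lambda>_. 1) {E0, E1}" "agree_upto (\<lambda>_. 1) n f v"
  using assms unfolding pl_free_def carrier_free_lie by (blast elim: approximableD)

text \<open>A word of length at most one splits only with an empty factor. Hence brackets have no
  linear part, and the coefficient of a Lie series at \<open>[E0]\<close> is its
  \<open>e0\<close>-part.\<close>

lemma series_bracket_short:
  assumes "f [] = 0" "g [] = 0"
  shows "series_bracket f g [] = 0" "series_bracket f g [a] = 0"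
  using assms by (simp_all add: series_bracket_def series_mult_def)

lemma lie_polys_Nil: "f \<in> lie_polys (\<lambda>_. 1) X \<Longrightarrow> f [] = 0"
  by (induction rule: lie_subalgebra_span.induct)
    (auto simp: letter_def series_scale_def series_bracket_short)

lemma pl_free_Nil: "f \<in> carrier pl_free \<Longrightarrow> f [] = 0"
  by (erule pl_free_agree[where n = 0])
    (metis agree_upto_def pl_word_weight lie_polys_Nil le_refl list.size(3))

lemma pl_monomial_carrier: "pl_monomial p f \<Longrightarrow> f \<in> carrier pl_free"
  by (induction rule: pl_monomial.induct) (auto simp: pl_free_closed)

lemma pl_monomial_E0: "pl_monomial p f \<Longrightarrow> p \<noteq> 0 \<Longrightarrow> f [E0] = 0"
  by (induction rule: pl_monomial.induct)
    (auto simp: letter_def series_bracket_short pl_free_Nil pl_monomial_carrier)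

lemma pl_monomial_homogeneous: "pl_monomial p f \<Longrightarrow> \<exists>n. pl_part n f = f"
proof (induction rule: pl_monomial.induct)
  case (3 p f q g)
  then obtain m n where mn: "pl_part m f = f" "pl_part n g = g" by auto
  \<comment> \<open>Homogeneity leaves only the term \<open>i = m\<close> in the decomposition of
    the bracket by degree.\<close>
  have "pl_part (m + n) (series_bracket f g) =
      (\<Sum>i\<le>m + n. if i = m then series_bracket f g else 0)"
    unfolding series_part_bracket
  proof (rule sum.cong)
    fix i
    have "pl_part i f = (if i = m then f else 0)"
      by (subst mn(1)[symmetric], subst series_part_part) (simp add: mn(1))
    then show "series_bracket (pl_part i f) (pl_part (m + n - i) g) =
        (if i = m then series_bracket f g else 0)"
      using mn by simp
  qed simp
  then show ?case by auto
qed (auto simp: series_part_letter)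

text \<open>Representatives of the basis elements in degree \<open>-n\<close> for
  \<open>n \<ge> 1\<close>; truncated subtraction makes \<open>ad_e0 0\<close> equal to
  \<open>ad_e0 1\<close>.\<close>

definition ad_e0 :: "nat \<Rightarrow> pl_letter list \<Rightarrow> 'r::rat_algebra" where
  "ad_e0 n = (ad pl_free (letter E0) ^^ (n - 1)) (letter E1)"

lemma ad_e0_simps:
  "ad_e0 1 = letter E1"
  "1 \<le> n \<Longrightarrow> ad_e0 (Suc n) = series_bracket (letter E0) (ad_e0 n)"
  by (cases n; simp add: ad_e0_def ad_def)+

lemma pl_monomial_ad_e0: "1 \<le> n \<Longrightarrow> pl_monomial 1 (ad_e0 n)"
proof (induction n rule: nat_induct_at_least)
  case (Suc n)
  then show ?case
    using pl_monomial.intros(3)[OF pl_monomial.intros(1), of 1 "ad_e0 n"] by (simp add: ad_e0_simps)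
qed (simp add: ad_e0_simps pl_monomial.intros(2))

lemma ad_e0_carrier [simp]: "1 \<le> n \<Longrightarrow> ad_e0 n \<in> carrier pl_free"
  using pl_monomial_carrier pl_monomial_ad_e0 by blast

section \<open>The graded closed ideal of relations\<close>

definition pl_relators :: "enat \<Rightarrow> (pl_letter list \<Rightarrow> 'r::rat_algebra) set" where
  "pl_relators N = {f. \<exists>p>1. pl_monomial p f} \<union> {ad_e0 n |n. 1 \<le> n \<and> N < enat n}"

abbreviation pl_relation_span :: "enat \<Rightarrow> (pl_letter list \<Rightarrow> 'r::rat_algebra) set" where
  "pl_relation_span N \<equiv> lie_ideal_span pl_free (pl_relators N)"

lemma pl_relation_span_closed:
  "0 \<in> pl_relation_span N"
  "f \<in> pl_relators N \<Longrightarrow> f \<in> pl_relation_span N"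
  "f \<in> pl_relation_span N \<Longrightarrow> g \<in> pl_relation_span N \<Longrightarrow> f + g \<in> pl_relation_span N"
  "f \<in> pl_relation_span N \<Longrightarrow> series_scale r f \<in> pl_relation_span N"
  "a \<in> carrier pl_free \<Longrightarrow> f \<in> pl_relation_span N \<Longrightarrow> series_bracket a f \<in> pl_relation_span N"
  using lie_ideal_span.intros[where L = pl_free and B = "pl_relators N"] by simp_all

lemma pl_relators_monomial: "f \<in> pl_relators N \<Longrightarrow> \<exists>p. pl_monomial p f"
  unfolding pl_relators_def using pl_monomial_ad_e0 by blast

lemma pl_relation_span_carrier: "f \<in> pl_relation_span N \<Longrightarrow> f \<in> carrier pl_free"
proof (induction rule: lie_ideal_span.induct)
  case (base b)
  then show ?case using pl_relators_monomial pl_monomial_carrier by blast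
qed (simp_all only: pl_free_simps pl_free_closed)

text \<open>Relators are Lie monomials and therefore homogeneous, so the ideal they generate is
  graded. This makes the projections descend to the quotient.\<close>

lemma pl_relation_span_part: "f \<in> pl_relation_span N \<Longrightarrow> pl_part n f \<in> pl_relation_span N"
proof (induction arbitrary: n rule: lie_ideal_span.induct)
  case (base b)
  then obtain m where "pl_part m b = b"
    using pl_relators_monomial pl_monomial_homogeneous by blast
  then have "pl_part n b = (if n = m then b else 0)"
    by (metis series_part_part)
  then show ?case by (simp add: pl_relation_span_closed base)
next
  case (bracket a b)
  then show ?case
    by (simp only: pl_free_simps series_part_bracket)
      (intro sum_in_closed pl_relation_span_closed(1,3,5) pl_free_closed)
qed (simp_all add: series_part_add series_part_scale pl_relation_span_closed)

lemma pl_ideal_iff: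
  "f \<in> pl_ideal N \<longleftrightarrow> f \<in> carrier pl_free \<and> approximable (\<lambda>_. 1) (pl_relation_span N) f"
  unfolding pl_ideal_def
  by (simp add: degree_closure_iff[OF pl_free_simps(5)] pl_relators_def ad_e0_def)

lemma pl_ideal_carrier: "f \<in> pl_ideal N \<Longrightarrow> f \<in> carrier pl_free"
  by (simp add: pl_ideal_iff)

lemma pl_relation_span_ideal: "f \<in> pl_relation_span N \<Longrightarrow> f \<in> pl_ideal N"
  using pl_relation_span_carrier approximable_mem unfolding pl_ideal_iff by blast

text \<open>The ideal span has the linear, bracket and projection properties, and compatibility with
  truncation carries them to the closure. Negation and brackets from the right come from scaling by
  \<open>- 1\<close> and antisymmetry.\<close>

lemma pl_ideal_closed:
  "0 \<in> pl_ideal N"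
  "f \<in> pl_ideal N \<Longrightarrow> g \<in> pl_ideal N \<Longrightarrow> f + g \<in> pl_ideal N"
  "f \<in> pl_ideal N \<Longrightarrow> series_scale r f \<in> pl_ideal N"
  "f \<in> pl_ideal N \<Longrightarrow> - f \<in> pl_ideal N"
  "f \<in> pl_ideal N \<Longrightarrow> g \<in> pl_ideal N \<Longrightarrow> f - g \<in> pl_ideal N"
  "a \<in> carrier pl_free \<Longrightarrow> f \<in> pl_ideal N \<Longrightarrow> series_bracket a f \<in> pl_ideal N"
  "a \<in> carrier pl_free \<Longrightarrow> f \<in> pl_ideal N \<Longrightarrow> series_bracket f a \<in> pl_ideal N"
  "f \<in> pl_ideal N \<Longrightarrow> pl_part n f \<in> pl_ideal N"
proof -
  show zero: "0 \<in> pl_ideal N"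
    by (simp add: pl_relation_span_ideal pl_relation_span_closed)
  show add: "f + g \<in> pl_ideal N" if "f \<in> pl_ideal N" "g \<in> pl_ideal N" for f g
    using that pl_free_closed(2) approximable_add[OF _ _ pl_relation_span_closed(3)]
    unfolding pl_ideal_iff by auto
  show scale: "series_scale r f \<in> pl_ideal N" if "f \<in> pl_ideal N" for f r
    using that pl_free_closed(3) approximable_map[OF _ agree_upto_scale pl_relation_span_closed(4)]
    unfolding pl_ideal_iff by auto
  show minus: "- f \<in> pl_ideal N" if "f \<in> pl_ideal N" for f
    using scale[OF that, of "- 1"] by (simp add: series_scale_minus_one)
  show "f - g \<in> pl_ideal N" if "f \<in> pl_ideal N" "g \<in> pl_ideal N" for f g
    using add[OF that(1) minus[OF that(2)]] by simp
  show left: "series_bracket a f \<in> pl_ideal N" if "a \<in> carrier pl_free" "f \<in> pl_ideal N" for a f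
    using that pl_free_closed(4)
      approximable_bracket[OF approximable_mem, of a "carrier pl_free"] pl_relation_span_closed(5)
    unfolding pl_ideal_iff by blast
  show "series_bracket f a \<in> pl_ideal N" if "a \<in> carrier pl_free" "f \<in> pl_ideal N" for a f
    using minus[OF left[OF that]] by (simp add: series_bracket_swap[of f a])
  show "pl_part n f \<in> pl_ideal N" if "f \<in> pl_ideal N" for f
    using that pl_free_closed(5) approximable_map[OF _ agree_upto_part pl_relation_span_part]
    unfolding pl_ideal_iff by auto
qed

text \<open>A homogeneous element of the closure already lies in the ideal span, because an
  approximant can be cut down to its degree. The partial sums of the parts of \<open>f\<close> are
  then approximants of \<open>f\<close>.\<close>

lemma pl_ideal_separated:
  assumes "f \<in> carrier pl_free" "\<And>n. pl_part n f \<in> pl_ideal N"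
  shows "f \<in> pl_ideal N"
  unfolding pl_ideal_iff
proof (intro conjI)
  have "pl_part k f \<in> pl_relation_span N" for k
  proof -
    obtain v where "v \<in> pl_relation_span N" "agree_upto (\<lambda>_. 1) k (pl_part k f) v"
      using assms(2)[of k] unfolding pl_ideal_iff by (blast elim: approximableD)
    then have "pl_part k f = pl_part k v"
      by (metis agree_upto_iff_series_part order_refl series_part_part)
    with \<open>v \<in> _\<close> show ?thesis by (simp add: pl_relation_span_part)
  qed
  then have "(\<Sum>k\<le>n. pl_part k f) \<in> pl_relation_span N" for n
    by (intro sum_in_closed) (simp_all add: pl_relation_span_closed)
  then show "approximable (\<lambda>_. 1) (pl_relation_span N) f"
    unfolding approximable_def using agree_upto_sum_parts by blast
qed (rule assms(1))

lemma ad_e0_in_pl_ideal: "1 \<le> n \<Longrightarrow> N < enat n \<Longrightarrow> ad_e0 n \<in> pl_ideal N"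
  by (rule pl_relation_span_ideal, rule pl_relation_span_closed) (auto simp: pl_relators_def)

section \<open>Lie series without \<open>e0\<close>-part and their brackets\<close>

abbreviation pl_positive :: "(pl_letter list \<Rightarrow> 'r::rat_algebra) set" where
  "pl_positive \<equiv> submodule_span pl_free {f. \<exists>p>0. pl_monomial p f}"

lemma pl_positive_closed:
  "0 \<in> pl_positive"
  "p > 0 \<Longrightarrow> pl_monomial p f \<Longrightarrow> f \<in> pl_positive"
  "f \<in> pl_positive \<Longrightarrow> g \<in> pl_positive \<Longrightarrow> f + g \<in> pl_positive"
  "f \<in> pl_positive \<Longrightarrow> series_scale r f \<in> pl_positive"
  using submodule_span.intros[where L = pl_free and B = "{f. \<exists>p>0. pl_monomial p f}"] by auto

lemma pl_positive_E0: "f \<in> pl_positive \<Longrightarrow> f [E0] = 0"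
  by (induction rule: submodule_span.induct)
    (auto simp: pl_monomial_E0 series_scale_def)

text \<open>The \<open>e1\<close>-degree is additive, and \<open>q\<close> may be \<open>0\<close>:
  bracketing with \<open>e0\<close> also preserves the span.\<close>

lemma pl_positive_monomial_bracket:
  assumes "f \<in> pl_positive" "pl_monomial q g"
  shows "series_bracket g f \<in> pl_positive"
  using assms(1)
proof (induction rule: submodule_span.induct)
  case (base b)
  then obtain p where "p > 0" "pl_monomial p b" by blast
  then show ?case
    using pl_monomial.intros(3)[OF assms(2), of p b] pl_positive_closed(2)[of "q + p"] by simp
qed (simp_all only: pl_free_simps pl_positive_closed series_bracket_zero series_bracket_add_right
    series_bracket_scale_right)

text \<open>By bilinearity both factors may be taken to be monomials of \<open>e1\<close>-degree at
  least one; their bracket has \<open>e1\<close>-degree at least two and is a relator.\<close>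

lemma pl_positive_bracket:
  assumes "f \<in> pl_positive" "g \<in> pl_positive"
  shows "series_bracket f g \<in> pl_positive" "series_bracket f g \<in> pl_relation_span N"
proof -
  show "series_bracket f g \<in> pl_positive"
    using assms(1)
  proof (induction rule: submodule_span.induct)
    case (base b)
    then show ?case using pl_positive_monomial_bracket assms(2) by blast
  qed (simp_all only: pl_free_simps pl_positive_closed series_bracket_zero series_bracket_add_left
      series_bracket_scale_left)
  have monomial: "series_bracket a g \<in> pl_relation_span N" if a: "p > 0" "pl_monomial p a" for p a
    using assms(2)
  proof (induction rule: submodule_span.induct)
    case (base b)
    then obtain q where q: "q > 0" "pl_monomial q b" by blast
    with a have "pl_monomial (p + q) (series_bracket a b)" "p + q > 1"
      using pl_monomial.intros(3)[OF a(2) q(2)] by simp_all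
    then show ?case by (intro pl_relation_span_closed) (auto simp: pl_relators_def)
  qed (simp_all only: pl_free_simps pl_relation_span_closed(1,3,4) series_bracket_zero
      series_bracket_add_right series_bracket_scale_right)
  show "series_bracket f g \<in> pl_relation_span N"
    using assms(1)
  proof (induction rule: submodule_span.induct)
    case (base b)
    then show ?case using monomial by blast
  qed (simp_all only: pl_free_simps pl_relation_span_closed(1,3,4) series_bracket_zero
      series_bracket_add_left series_bracket_scale_left)
qed

text \<open>In the induction over the span, brackets feed only the positive part, since the bracket
  of \<open>e0\<close> with itself vanishes.\<close>

lemma lie_polys_decompose:
  assumes "f \<in> lie_polys (\<lambda>_. 1) {E0, E1}"
  obtains s m where "f = series_scale s (letter E0) + m" "m \<in> pl_positive"
proof -
  have "\<exists>s. \<exists>m\<in>pl_positive. f = series_scale s (letter E0) + m"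
    using assms
  proof (induction rule: lie_subalgebra_span.induct)
    case zero
    show ?case
      using pl_positive_closed(1) by (intro exI[of _ 0] bexI[of _ 0]) auto
  next
    case (base b)
    then consider "b = letter E0" | "b = letter E1" by blast
    then show ?case
    proof cases
      case 1
      then show ?thesis
        using pl_positive_closed(1)
        by (intro exI[of _ 1] bexI[of _ 0]) (auto simp: series_scale_def fun_eq_iff)
    next
      case 2
      then show ?thesis
        using pl_positive_closed(2)[OF _ pl_monomial.intros(2)]
        by (intro exI[of _ 0] bexI[of _ "letter E1"]) auto
    qed
  next
    case (add a b)
    then obtain s m s' m' where m: "m \<in> pl_positive" "m' \<in> pl_positive"
      and "a = series_scale s (letter E0) + m" "b = series_scale s' (letter E0) + m'" by blast
    then show ?case
      by (intro exI[of _ "s + s'"] bexI[of _ "m + m'"])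
        (auto simp: series_scale_add_left pl_positive_closed)
  next
    case (smult a r)
    then obtain s m where m: "m \<in> pl_positive" and "a = series_scale s (letter E0) + m" by blast
    then show ?case
      by (intro exI[of _ "r * s"] bexI[of _ "series_scale r m"])
        (auto simp: series_scale_add_right series_scale_scale pl_positive_closed)
  next
    case (bracket a b)
    then obtain s m s' m' where m: "m \<in> pl_positive" "m' \<in> pl_positive"
      and ab: "a = series_scale s (letter E0) + m" "b = series_scale s' (letter E0) + m'" by blast
    let ?e = "letter E0"
    \<comment> \<open>The term in \<open>e0\<close> with itself drops out; turning the bracket of
      \<open>m\<close> with \<open>e0\<close> around produces the sign in
      \<open>- s'\<close>.\<close>
    have "series_bracket a b = series_scale s (series_bracket ?e m') +
        series_scale (- s') (series_bracket ?e m) + series_bracket m m'"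
      by (simp add: ab series_bracket_add_left series_bracket_add_right series_bracket_scale_left
          series_bracket_scale_right series_bracket_swap[of m ?e])
        (simp add: series_scale_def fun_eq_iff)
    \<comment> \<open>A bracket has no \<open>e0\<close>-part, so the witnesses are the scalar
      \<open>0\<close> and the whole bracket.\<close>
    then show ?case
      using m
      by (intro exI[of _ 0] bexI[of _ "series_bracket a b"])
        (auto intro!: pl_positive_closed(3,4) pl_positive_bracket
          pl_positive_monomial_bracket[OF _ pl_monomial.intros(1)])
  qed
  then show ?thesis using that by blast
qed

lemma lie_polys_positive:
  assumes "f \<in> lie_polys (\<lambda>_. 1) {E0, E1}" "f [E0] = 0"
  shows "f \<in> pl_positive"
proof -
  obtain s m where f: "f = series_scale s (letter E0) + m" "m \<in> pl_positive"
    using lie_polys_decompose[OF assms(1)] .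
  then have "s = 0"
    using assms(2) pl_positive_E0[OF f(2)] by (simp add: series_scale_def letter_def)
  with f show ?thesis by simp
qed

text \<open>Approximants by Lie polynomials inherit the absence of an \<open>e0\<close>-part, and
  brackets of such polynomials lie in the ideal span for every \<open>N\<close>.\<close>

lemma bracket_in_pl_ideal:
  assumes "f \<in> carrier pl_free" "f [E0] = 0" "g \<in> carrier pl_free" "g [E0] = 0"
  shows "series_bracket f g \<in> pl_ideal N"
  unfolding pl_ideal_iff approximable_def
proof (intro conjI allI)
  show "series_bracket f g \<in> carrier pl_free" using assms by (simp add: pl_free_closed)
  fix n
  \<comment> \<open>Precision \<open>Suc n\<close> is at least one even for \<open>n = 0\<close>, so
    the approximants also have coefficient zero at \<open>[E0]\<close>, a word of weight
    one.\<close>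
  obtain v where v: "v \<in> lie_polys (\<lambda>_. 1) {E0, E1}" "agree_upto (\<lambda>_. 1) (Suc n) f v"
    using pl_free_agree[OF assms(1)] .
  obtain w where w: "w \<in> lie_polys (\<lambda>_. 1) {E0, E1}" "agree_upto (\<lambda>_. 1) (Suc n) g w"
    using pl_free_agree[OF assms(3)] .
  have "v [E0] = 0" "w [E0] = 0"
    using v(2) w(2) assms(2,4) by (simp_all add: agree_upto_def pl_word_weight)
  then have "series_bracket v w \<in> pl_relation_span N"
    using v w by (intro pl_positive_bracket lie_polys_positive)
  moreover have "agree_upto (\<lambda>_. 1) n (series_bracket f g) (series_bracket v w)"
    using v(2) w(2) by (intro agree_upto_bracket) (auto elim: agree_upto_mono)
  ultimately show "\<exists>v\<in>pl_relation_span N. agree_upto (\<lambda>_. 1) n (series_bracket f g) v" by blast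
qed

section \<open>The quotient in terms of representatives\<close>

abbreviation pl_class ::
  "enat \<Rightarrow> (pl_letter list \<Rightarrow> 'r::rat_algebra) \<Rightarrow> (pl_letter list \<Rightarrow> 'r) set" where
  "pl_class N f \<equiv> pl_ideal N +>\<^bsub>pl_free\<^esub> f"

lemma mem_pl_class: "g \<in> pl_class N f \<longleftrightarrow> g - f \<in> pl_ideal N"
proof -
  have "g \<in> pl_class N f \<longleftrightarrow> (\<exists>h\<in>pl_ideal N. g = h + f)"
    by (auto simp: a_r_coset_def r_coset_def)
  also have "\<dots> \<longleftrightarrow> g - f \<in> pl_ideal N"
    by (metis add_diff_cancel_right' diff_add_cancel)
  finally show ?thesis .
qed

lemma pl_class_eq_iff: "pl_class N f = pl_class N g \<longleftrightarrow> f - g \<in> pl_ideal N"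
proof
  assume "pl_class N f = pl_class N g"
  then have "f \<in> pl_class N g" using mem_pl_class[of f N f] by (simp add: pl_ideal_closed)
  then show "f - g \<in> pl_ideal N" by (simp add: mem_pl_class)
next
  assume fg: "f - g \<in> pl_ideal N"
  have "h - f \<in> pl_ideal N \<longleftrightarrow> h - g \<in> pl_ideal N" for h
    using pl_ideal_closed(2)[OF _ fg, of "h - f"] pl_ideal_closed(5)[OF _ fg, of "h - g"] by auto
  then show "pl_class N f = pl_class N g" by (auto simp: mem_pl_class)
qed

lemma pl_class_eq_zero_iff: "pl_class N f = pl_class N 0 \<longleftrightarrow> f \<in> pl_ideal N"
  by (simp add: pl_class_eq_iff)

lemma pl_class_absorb: "g \<in> pl_ideal N \<Longrightarrow> pl_class N (f + g) = pl_class N f"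
  by (simp add: pl_class_eq_iff)

text \<open>The quotient operations are unions over all representatives of a coset; a value
  independent of the representative collapses such a union.\<close>

lemma pl_class_bind:
  assumes "\<And>g. g - f \<in> pl_ideal N \<Longrightarrow> h g = A"
  shows "(\<Union>g\<in>pl_class N f. h g) = A"
proof -
  have "f \<in> pl_class N f" by (simp add: mem_pl_class pl_ideal_closed)
  moreover have "h g = A" if "g \<in> pl_class N f" for g
    using that assms by (simp add: mem_pl_class)
  ultimately show ?thesis by blast
qed

lemma PL_carrier: "carrier (PL N) = pl_class N ` carrier pl_free"
  by (auto simp: PL_def lie_quotient_def A_RCOSETS_def RCOSETS_def a_r_coset_def)

lemma PL_add [simp]: "pl_class N f \<oplus>\<^bsub>PL N\<^esub> pl_class N g = pl_class N (f + g)"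
proof -
  have "pl_class N f \<oplus>\<^bsub>PL N\<^esub> pl_class N g = {h + k |h k. h \<in> pl_class N f \<and> k \<in> pl_class N g}"
    unfolding PL_def lie_quotient_def set_add_def set_mult_def by auto
  also have "\<dots> = pl_class N (f + g)"
  proof (intro equalityI subsetI)
    fix l
    assume "l \<in> {h + k |h k. h \<in> pl_class N f \<and> k \<in> pl_class N g}"
    then obtain h k where "l = h + k" "h - f \<in> pl_ideal N" "k - g \<in> pl_ideal N"
      by (auto simp: mem_pl_class)
    moreover have "h + k - (f + g) = (h - f) + (k - g)" by simp
    ultimately show "l \<in> pl_class N (f + g)"
      by (metis mem_pl_class pl_ideal_closed(2))
  next
    fix l
    assume "l \<in> pl_class N (f + g)"
    then have "l = (l - g) + g" "l - g \<in> pl_class N f" "g \<in> pl_class N g"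
      by (simp_all add: mem_pl_class pl_ideal_closed algebra_simps)
    then show "l \<in> {h + k |h k. h \<in> pl_class N f \<and> k \<in> pl_class N g}" by blast
  qed
  finally show ?thesis .
qed

lemma PL_zero: "\<zero>\<^bsub>PL N\<^esub> = pl_class N 0"
  by (auto simp: PL_def lie_quotient_def mem_pl_class)

lemma PL_smult [simp]: "r \<odot>\<^bsub>PL N\<^esub> pl_class N f = pl_class N (series_scale r f)"
proof -
  have "pl_class N (series_scale r g) = pl_class N (series_scale r f)" if "g - f \<in> pl_ideal N" for g
    using that by (simp add: pl_class_eq_iff pl_ideal_closed flip: series_scale_diff_right)
  from pl_class_bind[OF this] show ?thesis by (simp add: PL_def lie_quotient_def)
qed

lemma PL_component [simp]: "component (PL N) n (pl_class N f) = pl_class N (pl_part n f)"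
proof -
  have "pl_class N (pl_part n g) = pl_class N (pl_part n f)" if "g - f \<in> pl_ideal N" for g
    using that by (simp add: pl_class_eq_iff pl_ideal_closed flip: series_part_diff)
  from pl_class_bind[OF this] show ?thesis by (simp add: PL_def lie_quotient_def)
qed

lemma PL_bracket:
  assumes "f \<in> carrier pl_free" "g \<in> carrier pl_free"
  shows "pl_class N f \<otimes>\<^bsub>PL N\<^esub> pl_class N g = pl_class N (series_bracket f g)"
proof -
  have "pl_class N (series_bracket a b) = pl_class N (series_bracket f g)"
    if "a - f \<in> pl_ideal N" "b - g \<in> pl_ideal N" for a b
  proof -
    \<comment> \<open>The ideal absorbs brackets with elements of \<open>pl_free\<close>. Splitting
      the difference into the brackets of \<open>a - f\<close> with \<open>b\<close> and of
      \<open>f\<close> with \<open>b - g\<close> thus calls for \<open>b\<close> to be a Lie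
      series.\<close>
    have "b \<in> carrier pl_free"
      using pl_free_closed(2)[OF pl_ideal_carrier[OF that(2)] assms(2)] by simp
    then show ?thesis
      using that assms by (simp add: pl_class_eq_iff series_bracket_diff pl_ideal_closed)
  qed
  then show ?thesis
    by (simp add: PL_def lie_quotient_def rcoset_mult_def pl_class_bind)
qed

lemma PL_separated:
  assumes "f \<in> carrier pl_free" "g \<in> carrier pl_free"
    and "\<And>n. pl_class N (pl_part n f) = pl_class N (pl_part n g)"
  shows "pl_class N f = pl_class N g"
  using assms
  by (simp add: pl_class_eq_iff pl_ideal_separated pl_free_closed flip: series_part_diff)

section \<open>Explicit brackets and sums in the polylogarithmic algebra\<close>

lemma PL_ad_power:
  assumes "1 \<le> n"
  shows "(ad (PL N) (e0 N) ^^ (n - 1)) (e1 N) = pl_class N (ad_e0 n)"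
  using assms
proof (induction n rule: nat_induct_at_least)
  case base
  show ?case by (simp add: e1_def ad_e0_simps(1))
next
  case (Suc n)
  \<comment> \<open>Writing the exponent \<open>Suc n - 1\<close> as a successor exposes the
    outermost \<open>ad\<close>.\<close>
  then obtain m where "n = Suc m" by (cases n) auto
  with Suc show ?case
    by (simp add: ad_def e0_def PL_bracket ad_e0_simps)
qed

text \<open>The representative \<open>s\<close> supplies the existence behind the description in
  \<open>homogeneous_sum\<close>; uniqueness holds since elements of the quotient are determined by
  their components.\<close>

lemma PL_homogeneous_sum:
  assumes s: "s \<in> carrier pl_free"
    and h: "\<And>n. pl_class N (pl_part n s) = (if n \<in> A then h n else pl_class N 0)"
  shows "homogeneous_sum (PL N) A h = pl_class N s"
  unfolding homogeneous_sum_def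
proof (rule the_equality)
  show "pl_class N s \<in> carrier (PL N) \<and>
      (\<forall>n. component (PL N) n (pl_class N s) = (if n \<in> A then h n else \<zero>\<^bsub>PL N\<^esub>))"
    using s h by (simp add: PL_carrier PL_zero)
next
  fix t
  assume t: "t \<in> carrier (PL N) \<and>
      (\<forall>n. component (PL N) n t = (if n \<in> A then h n else \<zero>\<^bsub>PL N\<^esub>))"
  then obtain g where "t = pl_class N g" "g \<in> carrier pl_free" by (auto simp: PL_carrier)
  moreover have "pl_class N (pl_part n g) = pl_class N (pl_part n s)" for n
    using t h[of n] calculation(1) PL_component[of N n g] by (simp add: PL_zero)
  ultimately show "t = pl_class N s"
    using PL_separated s by metis
qed

text \<open>Neither \<open>e1\<close> nor \<open>ad_e0 n\<close> has an \<open>e0\<close>-part, so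
  they commute in the quotient and only the multiple of \<open>e0\<close> acts.\<close>

lemma PL_ad_step:
  assumes "1 \<le> n"
  shows "pl_class N (series_scale r (letter E0) + series_scale s (letter E1)) \<otimes>\<^bsub>PL N\<^esub>
      pl_class N (series_scale t (ad_e0 n)) = pl_class N (series_scale (r * t) (ad_e0 (Suc n)))"
proof -
  have "ad_e0 n [E0] = (0 :: 'a)"
    using assms pl_monomial_E0[OF pl_monomial_ad_e0] by simp
  then have "series_bracket (letter E1) (ad_e0 n :: _ \<Rightarrow> 'a) \<in> pl_ideal N"
    using assms by (intro bracket_in_pl_ideal) (simp_all, simp add: letter_def)
  then show ?thesis
    using assms
    by (simp add: PL_bracket pl_free_closed series_bracket_add_left series_bracket_scale_left
        series_bracket_scale_right series_scale_add_right series_scale_scale mult.commute[of t]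
        ad_e0_simps pl_class_absorb pl_ideal_closed)
qed

text \<open>The identity already holds between the representatives, by bilinearity and antisymmetry;
  the scalar is a two-by-two determinant.\<close>

lemma PL_degree_one_bracket:
  "pl_class N (series_scale r (letter E0) + series_scale s (letter E1)) \<otimes>\<^bsub>PL N\<^esub>
      pl_class N (series_scale r' (letter E0) + series_scale s' (letter E1)) =
    pl_class N (series_scale (r * s' - r' * s) (ad_e0 2))"
proof -
  have ad_e0_2: "ad_e0 2 = series_bracket (letter E0) (letter E1)"
    using ad_e0_simps(2)[of 1] by (simp add: ad_e0_simps(1))
  have "series_bracket (series_scale r (letter E0) + series_scale s (letter E1))
      (series_scale r' (letter E0) + series_scale s' (letter E1)) =
      series_scale (r * s' - r' * s) (ad_e0 2)"
    by (simp add: ad_e0_2 series_bracket_add_left series_bracket_add_right series_bracket_scale_left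
        series_bracket_scale_right series_bracket_swap[of "letter E1" "letter E0"])
      (simp add: series_scale_def fun_eq_iff left_diff_distrib right_diff_distrib mult_ac)
  then show ?thesis by (simp add: PL_bracket pl_free_closed)
qed

section \<open>Homogeneous elements\<close>

context pronilpotent_graded_lie
begin

definition homogeneous :: "nat \<Rightarrow> 'l set" where
  "homogeneous n = {a \<in> carrier L. component L n a = a}"

lemma homogeneous_carrier: "a \<in> homogeneous n \<Longrightarrow> a \<in> carrier L"
  by (simp add: homogeneous_def)

lemma component_of_zero [simp]: "component L n \<zero> = \<zero>"
  using component_add[of \<zero> \<zero> n] component_closed[of \<zero> n]
  by (metis add.r_cancel_one' r_zero zero_closed)

lemma homogeneous_zero [simp]: "\<zero> \<in> homogeneous n"
  by (simp add: homogeneous_def)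

lemma homogeneous_add: "a \<in> homogeneous n \<Longrightarrow> b \<in> homogeneous n \<Longrightarrow> a \<oplus> b \<in> homogeneous n"
  by (simp add: homogeneous_def component_add)

lemma homogeneous_smult: "a \<in> homogeneous n \<Longrightarrow> r \<odot> a \<in> homogeneous n"
  by (simp add: homogeneous_def component_smult smult_closed)

lemma homogeneous_finsum:
  assumes "\<And>i. i \<in> A \<Longrightarrow> f i \<in> homogeneous n"
  shows "finsum L f A \<in> homogeneous n"
  using assms
proof (induction A rule: infinite_finite_induct)
  case (insert i A)
  then have "f \<in> A \<rightarrow> carrier L" "f i \<in> carrier L" by (auto simp: homogeneous_def)
  with insert show ?case by (simp add: homogeneous_add)
qed simp_all

lemma component_homogeneous:
  assumes "a \<in> homogeneous n"
  shows "component L m a = (if m = n then a else \<zero>)"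
  using assms component_component[of a m n] by (simp add: homogeneous_def)

lemma bracket_zero:
  assumes "a \<in> carrier L"
  shows "\<zero> \<otimes> a = \<zero>" "a \<otimes> \<zero> = \<zero>"
  using bracket_add_left[of \<zero> \<zero> a] bracket_add_right[of a \<zero> \<zero>]
    bracket_closed[of \<zero> a] bracket_closed[of a \<zero>] assms
  by (metis add.r_cancel_one' r_zero zero_closed)+

lemma homogeneous_bracket:
  assumes a: "a \<in> homogeneous m" and b: "b \<in> homogeneous n"
  shows "a \<otimes> b \<in> homogeneous (m + n)"
proof -
  note ab [simp] = homogeneous_carrier[OF a] homogeneous_carrier[OF b]
  have "component L (m + n) (a \<otimes> b) =
      (\<Oplus>i\<in>{..m + n}. component L i a \<otimes> component L (m + n - i) b)"
    by (simp add: component_bracket)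
  also have "\<dots> = (\<Oplus>i\<in>{..m + n}. if m = i then a \<otimes> b else \<zero>)"
    by (intro finsum_cong')
      (auto simp: component_homogeneous[OF a] component_homogeneous[OF b] bracket_zero bracket_closed)
  also have "\<dots> = a \<otimes> b"
    by (intro add.finprod_singleton) (auto simp: bracket_closed)
  finally show ?thesis by (simp add: homogeneous_def bracket_closed)
qed

lemma homogeneous_ad_tuple:
  assumes "\<And>i. i \<in> set u \<Longrightarrow> \<tau> i \<in> homogeneous 1" "b \<in> homogeneous m"
  shows "foldr (\<lambda>i. ad L (\<tau> i)) u b \<in> homogeneous (length u + m)"
  using assms
proof (induction u)
  case (Cons i u)
  then show ?case using homogeneous_bracket[of "\<tau> i" 1] by (simp add: ad_def plus_1_eq_Suc)
qed simp

text \<open>Completeness turns the description in \<open>homogeneous_sum\<close> into an actual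
  element; the index \<open>0\<close> is excluded because \<open>complete\<close> prescribes zero
  there.\<close>

lemma component_homogeneous_sum:
  assumes "\<And>n. n \<in> A \<Longrightarrow> f n \<in> homogeneous n" "0 \<notin> A"
  shows "homogeneous_sum L A f \<in> carrier L"
    and "component L n (homogeneous_sum L A f) = (if n \<in> A then f n else \<zero>)"
proof -
  have "\<exists>!s. s \<in> carrier L \<and> (\<forall>n. component L n s = (if n \<in> A then f n else \<zero>))"
    using assms by (intro complete) (auto simp: homogeneous_def)
  from theI'[OF this]
  show "homogeneous_sum L A f \<in> carrier L"
    and "component L n (homogeneous_sum L A f) = (if n \<in> A then f n else \<zero>)"
    unfolding homogeneous_sum_def by blast+
qed

text \<open>The letters are homogeneous in the free algebra, and the isomorphism commutes with the
  projections.\<close>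

lemma free_generators_homogeneous:
  assumes "free_on_generators L d \<tau> \<sigma>"
  shows "i \<in> {1..d 1} \<Longrightarrow> \<tau> i \<in> homogeneous 1"
    and "2 \<le> n \<Longrightarrow> i \<in> {1..d n} \<Longrightarrow> \<sigma> n i \<in> homogeneous n"
proof -
  let ?F = "free_lie mt_weight (mt_letters d) :: ('r, mt_letter list \<Rightarrow> 'r) graded_lie"
  obtain \<phi> where \<phi>: "\<phi> \<in> hom_gr ?F L"
    and \<tau>: "\<forall>i\<in>{1..d 1}. \<phi> (letter (Tau i)) = \<tau> i"
    and \<sigma>: "\<forall>n\<ge>2. \<forall>i\<in>{1..d n}. \<phi> (letter (Sig n i)) = \<sigma> n i"
    using assms unfolding free_on_generators_def by blast
  have image: "\<phi> (letter s) \<in> homogeneous (mt_weight s)" if "s \<in> mt_letters d" for s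
  proof -
    have s: "letter s \<in> carrier ?F" using that by (rule free_lie_letter)
    then have "component L (mt_weight s) (\<phi> (letter s)) =
        \<phi> (component ?F (mt_weight s) (letter s))"
      using \<phi> unfolding hom_gr_def by auto
    moreover have "\<phi> (letter s) \<in> carrier L"
      using \<phi> s unfolding hom_gr_def by auto
    ultimately show ?thesis by (simp add: homogeneous_def series_part_letter)
  qed
  show "\<tau> i \<in> homogeneous 1" if "i \<in> {1..d 1}"
    using image[of "Tau i"] that \<tau> by (simp add: mt_letters_def)
  show "\<sigma> n i \<in> homogeneous n" if "2 \<le> n" "i \<in> {1..d n}"
    using image[of "Sig n i"] that \<sigma> by (simp add: mt_letters_def)
qed

end

lemma finite_sorted_tuples [simp]: "finite (sorted_tuples p D)"
  by (rule finite_subset[OF _ finite_lists_length_eq[of "{1..D}" p]])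
    (auto simp: sorted_tuples_def)

text \<open>Degrees add up along an iterated bracket: to \<open>(n - 1) + 1\<close> in the words in
  the \<tau> alone and to \<open>(n - m) + m\<close> in the words ending in
  \<open>\<sigma> m i\<close>.\<close>

lemma (in pronilpotent_graded_lie) goncharov_term_homogeneous:
  assumes "free_on_generators L d \<tau> \<sigma>" "1 \<le> n"
  shows "goncharov_term L d \<tau> \<sigma> c n \<in> homogeneous n"
proof -
  note gen = free_generators_homogeneous[OF assms(1)]
  have "foldr (\<lambda>i. ad L (\<tau> i)) u (\<tau> j) \<in> homogeneous n"
    if "u \<in> sorted_tuples (n - 1) (d 1)" "j \<in> {1..d 1}" for u j
    using homogeneous_ad_tuple[of u \<tau> "\<tau> j" 1] that assms(2) gen(1)
    by (auto simp: sorted_tuples_def subset_iff)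
  moreover have "foldr (\<lambda>i. ad L (\<tau> i)) u (\<sigma> m i) \<in> homogeneous n"
    if "m \<in> {2..n}" "i \<in> {1..d m}" "u \<in> sorted_tuples (n - m) (d 1)" for u m i
    using homogeneous_ad_tuple[of u \<tau> "\<sigma> m i" m] that gen
    by (auto simp: sorted_tuples_def subset_iff)
  ultimately show ?thesis
    unfolding goncharov_term_def
    using gen(1) by (auto intro!: homogeneous_add homogeneous_finsum homogeneous_smult)
qed

section \<open>Sorted index tuples\<close>

lemma prod_list_insort:
  "prod_list (map f (insort i u)) = f i * prod_list (map (f :: _ \<Rightarrow> 'r::rat_algebra) u)"
  by (induction u) (auto simp: mult_ac)

lemma last_sorted_ge: "sorted u \<Longrightarrow> i \<in> set u \<Longrightarrow> i \<le> last u"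
  by (induction u) (auto split: if_splits)

text \<open>
  The second summand of \<open>x\<^bsub>last u\<^esub> y\<^sub>j - x\<^sub>j y\<^bsub>last u\<^esub>\<close> belongs to the tuple that arises from \<open>u\<close> by
  replacing the last entry by \<open>j\<close> and sorting, and whose final index is the old \<open>last u\<close>.
\<close>

lemma goncharov_c'_sum:
  fixes c :: "mt_letter list \<Rightarrow> 'r::rat_algebra"
  assumes "p > 0"
  shows "(\<Sum>u\<in>sorted_tuples p D. \<Sum>j\<in>{j\<in>{1..D}. j < last u}. c (map Tau (u @ [j])) *
      (prod_list (map x (butlast u)) * (x (last u) * y j - x j * y (last u)))) =
    (\<Sum>u\<in>sorted_tuples p D. \<Sum>j\<in>{1..D}. goncharov_c' c u j * prod_list (map x u) * y j)"
    (is "?lhs = ?rhs")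
proof -
  let ?T = "sorted_tuples p D"
  let ?P = "\<lambda>u. prod_list (map x u)"
  let ?C = "\<lambda>u j. c (map Tau (u @ [j]))"
  let ?lower = "\<lambda>u. {j\<in>{1..D}. j < last u}" and ?upper = "\<lambda>u. {j\<in>{1..D}. \<not> j < last u}"
  have nonempty: "u \<noteq> []" if "u \<in> ?T" for u
    using that assms by (auto simp: sorted_tuples_def)
  have P_last: "?P (butlast u) * x (last u) = ?P u" if "u \<in> ?T" for u
    using nonempty[OF that] by (cases u rule: rev_cases) simp_all
  \<comment> \<open>The determinant is split into its two products. The first already carries the
    required monomial; the second is reindexed.\<close>
  have "?lhs = (\<Sum>u\<in>?T. \<Sum>j\<in>?lower u. ?C u j * ?P u * y j) -
      (\<Sum>u\<in>?T. \<Sum>j\<in>?lower u. ?C u j * ?P (butlast u) * x j * y (last u))"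
    unfolding sum_subtractf[symmetric]
    by (intro sum.cong refl) (simp add: algebra_simps flip: P_last)
  also have "(\<Sum>u\<in>?T. \<Sum>j\<in>?lower u. ?C u j * ?P (butlast u) * x j * y (last u)) =
      (\<Sum>(u, j)\<in>Sigma ?T ?lower. ?C u j * ?P (butlast u) * x j * y (last u))"
    by (simp add: sum.Sigma)
  also have "\<dots> = (\<Sum>(u, j, i)\<in>Sigma ?T (\<lambda>u. Sigma (?upper u) (\<lambda>j. {i\<in>set u. i < j})).
      c (map Tau (remove1 i (u @ [j]) @ [i])) * ?P u * y j)"
  \<comment> \<open>A pair \<open>(u, i)\<close> goes to the sorted tuple with \<open>i\<close> in
    place of the last entry, the old last entry, and \<open>i\<close>; the inverse deletes one
    \<open>i\<close> and appends \<open>j\<close>. As \<open>i\<close> ranges over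
    \<open>set u\<close>, repeated entries count once, just as in
    \<open>goncharov_c'\<close>.\<close>
  proof (rule sum.reindex_bij_witness[of _ "\<lambda>(u, j, i). (remove1 i u @ [j], i)"
        "\<lambda>(u, i). (insort i (butlast u), last u, i)"], goal_cases)
    case (1 a)
    then obtain u i where a: "a = (u, i)" "u \<in> ?T" by auto
    then show ?case using nonempty by simp
  next
    case (2 a)
    then obtain u i where a: "a = (u, i)" and u: "u \<in> ?T" and i: "i \<in> {1..D}" "i < last u" by auto
    obtain v l where v: "u = v @ [l]" using nonempty[OF u] by (cases u rule: rev_cases) auto
    have "sorted v" "\<forall>k\<in>set v. k \<le> l" "length u = p" "set u \<subseteq> {1..D}"
      using u v by (auto simp: sorted_tuples_def sorted_append)
    \<comment> \<open>This puts the new final index \<open>l\<close> into the range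
      \<open>?upper\<close>.\<close>
    moreover have "last (insort i v) \<le> l"
    proof -
      have "insort i v \<noteq> []" by (cases v) auto
      then have "last (insort i v) \<in> set (insort i v)" by (rule last_in_set)
      then show ?thesis using calculation i v by (auto simp: set_insort_key)
    qed
    ultimately show ?case
      using i by (auto simp: a v sorted_tuples_def sorted_insort set_insort_key not_less)
  next
    case (3 b)
    then show ?case by (auto simp: insort_remove1 sorted_tuples_def)
  next
    case (4 b)
    then obtain u j i where b: "b = (u, j, i)" and u: "u \<in> ?T" and j: "j \<in> {1..D}" "last u \<le> j"
      and i: "i \<in> set u" "i < j" by auto
    have "set (remove1 i u) \<subseteq> set u" by (rule set_remove1_subset)
    \<comment> \<open>Appending \<open>j\<close> therefore keeps the tuple sorted, and its last
      entry \<open>j\<close> exceeds \<open>i\<close>.\<close>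
    then have "\<forall>k\<in>set (remove1 i u). k \<le> j"
      using u j last_sorted_ge unfolding sorted_tuples_def by fastforce
    then show ?case
      using u i j \<open>set (remove1 i u) \<subseteq> set u\<close> assms
      by (auto simp: b sorted_tuples_def sorted_append sorted_remove1 length_remove1)
  next
    case (5 a)
    then obtain u i where a: "a = (u, i)" and u: "u \<in> ?T" and i: "i < last u" by auto
    have "i \<in> set (insort i (butlast u))" by (simp add: set_insort_key)
    \<comment> \<open>Since \<open>i\<close> occurs in the front part, \<open>remove1\<close> acts
      there and gives back \<open>u\<close>, so the two words in \<open>c\<close> coincide.\<close>
    then have "remove1 i (insort i (butlast u) @ [last u]) = butlast u @ [last u]"
      by (simp add: remove1_append)
    then show ?case
      using nonempty[OF u] by (simp add: a prod_list_insort mult_ac)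
  qed
  also have "\<dots> = (\<Sum>u\<in>?T. \<Sum>j\<in>?upper u. \<Sum>i\<in>{i\<in>set u. i < j}.
      c (map Tau (remove1 i (u @ [j]) @ [i])) * ?P u * y j)"
    by (simp add: sum.Sigma split_def)
  \<comment> \<open>The sign comes from the second case of \<open>goncharov_c'\<close>; the minus of
    the determinant cancels it below.\<close>
  also have "\<dots> = - (\<Sum>u\<in>?T. \<Sum>j\<in>?upper u. goncharov_c' c u j * ?P u * y j)"
    unfolding sum_negf[symmetric]
    by (intro sum.cong refl) (simp add: goncharov_c'_def sum_distrib_right sum_negf)
  also have "(\<Sum>u\<in>?T. \<Sum>j\<in>?lower u. ?C u j * ?P u * y j) =
      (\<Sum>u\<in>?T. \<Sum>j\<in>?lower u. goncharov_c' c u j * ?P u * y j)"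
    by (intro sum.cong refl) (simp add: goncharov_c'_def)
  also have "\<dots> - - (\<Sum>u\<in>?T. \<Sum>j\<in>?upper u. goncharov_c' c u j * ?P u * y j) =
      (\<Sum>u\<in>?T. (\<Sum>j\<in>?lower u. goncharov_c' c u j * ?P u * y j) +
        (\<Sum>j\<in>?upper u. goncharov_c' c u j * ?P u * y j))"
    by (simp add: sum.distrib)
  also have "\<dots> = ?rhs"
  proof (intro sum.cong refl)
    fix u
    have "?lower u \<union> ?upper u = {1..D}" by auto
    then show "(\<Sum>j\<in>?lower u. goncharov_c' c u j * ?P u * y j) +
        (\<Sum>j\<in>?upper u. goncharov_c' c u j * ?P u * y j) =
        (\<Sum>j\<in>{1..D}. goncharov_c' c u j * ?P u * y j)"
      by (subst sum.union_disjoint[symmetric]) (simp_all only:, auto)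
  qed
  finally show ?thesis .
qed

declare plus_fun_apply [simp del] zero_fun_apply [simp del]

section \<open>Homomorphisms to the polylogarithmic Lie algebra\<close>

locale pl_homomorphism = pronilpotent_graded_lie L
  for L :: "('r::rat_algebra, 'u) graded_lie" (structure) +
  fixes N :: enat and \<xi> :: "'u \<Rightarrow> (pl_letter list \<Rightarrow> 'r) set"
  assumes hom: "\<xi> \<in> hom_gr L (PL N)"
begin

lemma hom_add: "a \<in> carrier L \<Longrightarrow> b \<in> carrier L \<Longrightarrow> \<xi> (a \<oplus> b) = \<xi> a \<oplus>\<^bsub>PL N\<^esub> \<xi> b"
  and hom_smult: "a \<in> carrier L \<Longrightarrow> \<xi> (r \<odot> a) = r \<odot>\<^bsub>PL N\<^esub> \<xi> a"
  and hom_bracket: "a \<in> carrier L \<Longrightarrow> b \<in> carrier L \<Longrightarrow> \<xi> (a \<otimes> b) = \<xi> a \<otimes>\<^bsub>PL N\<^esub> \<xi> b"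
  and hom_component: "a \<in> carrier L \<Longrightarrow> \<xi> (component L n a) = component (PL N) n (\<xi> a)"
  using hom by (auto simp: hom_gr_def)

lemma hom_lift:
  assumes "a \<in> carrier L"
  obtains f where "f \<in> carrier pl_free" "\<xi> a = pl_class N f"
proof -
  have "\<xi> a \<in> carrier (PL N)" using hom assms by (auto simp: hom_gr_def)
  then show ?thesis using that by (auto simp: PL_carrier)
qed

lemma hom_zero: "\<xi> \<zero> = pl_class N 0"
proof -
  obtain f where f: "\<xi> \<zero> = pl_class N f" using hom_lift[OF zero_closed] .
  then have "pl_class N f = pl_class N (f + f)"
    using hom_add[of \<zero> \<zero>] by simp
  then have "- f \<in> pl_ideal N" by (simp add: pl_class_eq_iff)
  then have "f \<in> pl_ideal N" using pl_ideal_closed(4) by fastforce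
  then show ?thesis by (simp add: f pl_class_eq_zero_iff)
qed

text \<open>All terms are multiples of one fixed series \<open>v\<close>, so the sum passes to the
  scalars; nested sums are treated by repeated application.\<close>

lemma hom_finsum:
  assumes "\<And>i. i \<in> A \<Longrightarrow> f i \<in> carrier L"
    and "\<And>i. i \<in> A \<Longrightarrow> \<xi> (f i) = pl_class N (series_scale (s i) v)"
  shows "\<xi> (finsum L f A) = pl_class N (series_scale (\<Sum>i\<in>A. s i) v)"
  using assms
proof (induction A rule: infinite_finite_induct)
  case (insert i A)
  then have "finsum L f (insert i A) = f i \<oplus> finsum L f A" "finsum L f A \<in> carrier L"
    by (auto intro!: finsum_insert finsum_closed)
  with insert show ?case by (simp add: hom_add series_scale_add_left)
qed (simp_all add: hom_zero)

text \<open>The degree \<open>-1\<close> part of any representative lies in the ideal; subtracting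
  it removes the coefficient at \<open>[E0]\<close>.\<close>

lemma hom_degree_le_minus_2:
  assumes "a \<in> degree_le_minus_2 L"
  obtains f where "f \<in> carrier pl_free" "\<xi> a = pl_class N f" "f [E0] = 0"
proof -
  have a: "a \<in> carrier L" "component L 1 a = \<zero>"
    using assms by (auto simp: degree_le_minus_2_def)
  obtain f where f: "f \<in> carrier pl_free" "\<xi> a = pl_class N f" using hom_lift[OF a(1)] .
  then have "pl_part 1 f \<in> pl_ideal N"
    using hom_component[OF a(1), of 1] a(2) pl_class_eq_zero_iff[of N "pl_part 1 f"]
    by (simp add: hom_zero)
  then have "pl_class N (f - pl_part 1 f) = \<xi> a"
    by (simp add: f(2) pl_class_eq_iff pl_ideal_closed)
  moreover have "(f - pl_part 1 f) [E0] = 0"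
    by (simp add: series_part_def pl_word_weight)
  ultimately show ?thesis using that f by (metis pl_free_closed(5,6))
qed

text \<open>The spanning brackets die by \<open>bracket_in_pl_ideal\<close>, and linearity extends
  this to the span. The closure follows degree by degree, as \<xi> commutes with the projections and
  the quotient is separated.\<close>

lemma hom_goncharov_ideal:
  assumes "\<gamma> \<in> goncharov_ideal L"
  shows "\<xi> \<gamma> = pl_class N 0"
proof -
  let ?B = "{a \<otimes> b |a b. a \<in> degree_le_minus_2 L \<and> b \<in> degree_le_minus_2 L}"
  have span: "v \<in> carrier L \<and> \<xi> v = pl_class N 0" if "v \<in> submodule_span L ?B" for v
    using that
  proof (induction rule: submodule_span.induct)
    case (base v)
    then obtain a b where v: "v = a \<otimes> b" and ab: "a \<in> degree_le_minus_2 L" "b \<in> degree_le_minus_2 L"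
      by blast
    obtain f where f: "f \<in> carrier pl_free" "\<xi> a = pl_class N f" "f [E0] = 0"
      using hom_degree_le_minus_2[OF ab(1)] .
    obtain g where g: "g \<in> carrier pl_free" "\<xi> b = pl_class N g" "g [E0] = 0"
      using hom_degree_le_minus_2[OF ab(2)] .
    have "a \<in> carrier L" "b \<in> carrier L" using ab by (auto simp: degree_le_minus_2_def)
    then show ?case
      using f g
      by (simp add: v bracket_closed hom_bracket PL_bracket pl_class_eq_zero_iff bracket_in_pl_ideal)
  qed (simp_all add: hom_zero hom_add hom_smult smult_closed)
  have \<gamma>: "\<gamma> \<in> carrier L"
    using assms by (simp add: goncharov_ideal_def degree_closure_def)
  then obtain f where f: "f \<in> carrier pl_free" "\<xi> \<gamma> = pl_class N f" by (rule hom_lift)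
  have "pl_class N (pl_part n f) = pl_class N (pl_part n 0)" for n
  proof -
    obtain v where v: "v \<in> submodule_span L ?B" "component L n \<gamma> = component L n v"
      using assms unfolding goncharov_ideal_def degree_closure_def by blast
    have "component (PL N) n (\<xi> \<gamma>) = \<xi> (component L n v)"
      using hom_component[OF \<gamma>, of n] v(2) by simp
    also have "\<dots> = component (PL N) n (pl_class N 0)"
      using hom_component[of v n] span[OF v(1)] by simp
    finally show ?thesis by (simp add: f(2))
  qed
  then show ?thesis
    unfolding f(2) by (rule PL_separated[OF f(1) pl_free_closed(1)])
qed

end

section \<open>Values of a homomorphism on the Goncharov terms\<close>

locale pl_evaluation = pl_homomorphism L N \<xi>
  for L :: "('r::rat_algebra, 'u) graded_lie" (structure) and N \<xi> +
  fixes d :: "nat \<Rightarrow> nat" and \<tau> :: "nat \<Rightarrow> 'u" and \<sigma> :: "nat \<Rightarrow> nat \<Rightarrow> 'u"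
    and x y :: "nat \<Rightarrow> 'r" and z :: "nat \<Rightarrow> nat \<Rightarrow> 'r"
  assumes free: "free_on_generators L d \<tau> \<sigma>"
    and hom_tau: "i \<in> {1..d 1} \<Longrightarrow>
      \<xi> (\<tau> i) = pl_class N (series_scale (x i) (letter E0) + series_scale (y i) (letter E1))"
    and hom_sigma: "2 \<le> n \<Longrightarrow> i \<in> {1..d n} \<Longrightarrow> \<xi> (\<sigma> n i) = pl_class N (series_scale (z n i) (ad_e0 n))"
begin

lemmas generators = free_generators_homogeneous[OF free, THEN homogeneous_carrier]

lemma ad_tuple_carrier:
  assumes "set u \<subseteq> {1..d 1}" "b \<in> carrier L"
  shows "foldr (\<lambda>i. ad L (\<tau> i)) u b \<in> carrier L"
  using assms generators(1) by (induction u) (auto simp: ad_def intro!: bracket_closed)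

text \<open>By \<open>PL_ad_step\<close>, each letter of \<open>u\<close> contributes a factor
  \<open>x i\<close> and one power of \<open>ad e0\<close>.\<close>

lemma hom_ad_tuple:
  assumes "set u \<subseteq> {1..d 1}" "b \<in> carrier L" "1 \<le> m" "\<xi> b = pl_class N (series_scale r (ad_e0 m))"
  shows "\<xi> (foldr (\<lambda>i. ad L (\<tau> i)) u b) =
    pl_class N (series_scale (prod_list (map x u) * r) (ad_e0 (length u + m)))"
  using assms(1)
proof (induction u)
  case Nil
  then show ?case using assms by simp
next
  case (Cons i u)
  then have "\<xi> (foldr (\<lambda>i. ad L (\<tau> i)) (i # u) b) =
      \<xi> (\<tau> i) \<otimes>\<^bsub>PL N\<^esub> \<xi> (foldr (\<lambda>i. ad L (\<tau> i)) u b)"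
    using generators(1) ad_tuple_carrier[of u b] assms(2) by (simp add: ad_def hom_bracket)
  with Cons show ?case
    using assms(3) by (simp add: hom_tau PL_ad_step mult.assoc)
qed

text \<open>The innermost bracket joins two elements of degree \<open>-1\<close>, where both
  coordinates count and the determinant arises; the outer letters act from degree \<open>-2\<close>
  on as in \<open>hom_ad_tuple\<close>.\<close>

lemma hom_ad_tuple_tau:
  assumes "u \<noteq> []" "set u \<subseteq> {1..d 1}" "j \<in> {1..d 1}"
  shows "\<xi> (foldr (\<lambda>i. ad L (\<tau> i)) u (\<tau> j)) = pl_class N (series_scale
    (prod_list (map x (butlast u)) * (x (last u) * y j - x j * y (last u))) (ad_e0 (Suc (length u))))"
proof -
  obtain v l where u: "u = v @ [l]" using assms(1) by (cases u rule: rev_cases) auto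
  have "\<xi> (\<tau> l \<otimes> \<tau> j) = pl_class N (series_scale (x l * y j - x j * y l) (ad_e0 2))"
    using assms u generators(1) by (simp add: hom_bracket hom_tau PL_degree_one_bracket)
  moreover have "\<tau> l \<otimes> \<tau> j \<in> carrier L"
    using assms u generators(1) by (intro bracket_closed) auto
  ultimately show ?thesis
    using hom_ad_tuple[of v "\<tau> l \<otimes> \<tau> j" 2] assms u by (simp add: ad_def)
qed

text \<open>Degree \<open>-1\<close> involves two basis elements, so this case is kept apart from
  the sums of multiples of a single series in \<open>hom_finsum\<close>.\<close>

lemma hom_goncharov_term_1:
  "\<xi> (goncharov_term L d \<tau> \<sigma> c 1) = pl_class N
    (series_scale (\<Sum>i\<in>{1..d 1}. c [Tau i] * x i) (letter E0) +
     series_scale (\<Sum>i\<in>{1..d 1}. c [Tau i] * y i) (letter E1))"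
proof -
  have "\<xi> (\<Oplus>i\<in>A. c [Tau i] \<odot> \<tau> i) = pl_class N
      (series_scale (\<Sum>i\<in>A. c [Tau i] * x i) (letter E0) +
       series_scale (\<Sum>i\<in>A. c [Tau i] * y i) (letter E1))" if "A \<subseteq> {1..d 1}" for A
    using finite_subset[OF that finite_atLeastAtMost] that
  proof (induction A rule: finite_induct)
    case (insert i A)
    have "(\<Oplus>i\<in>insert i A. c [Tau i] \<odot> \<tau> i) = c [Tau i] \<odot> \<tau> i \<oplus> (\<Oplus>i\<in>A. c [Tau i] \<odot> \<tau> i)"
      "(\<Oplus>i\<in>A. c [Tau i] \<odot> \<tau> i) \<in> carrier L" "c [Tau i] \<odot> \<tau> i \<in> carrier L" "\<tau> i \<in> carrier L"
      using insert generators(1)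
      by (auto intro!: finsum_insert finsum_closed smult_closed)
    with insert show ?case
      by (simp add: hom_add hom_smult hom_tau series_scale_add_right series_scale_scale
          series_scale_add_left add_ac)
  qed (simp add: hom_zero)
  from this[of "{1..d 1}"] show ?thesis by (simp add: goncharov_term_def)
qed

lemma hom_goncharov_term:
  assumes "2 \<le> n"
  shows "\<xi> (goncharov_term L d \<tau> \<sigma> c n) = pl_class N (series_scale
    ((\<Sum>u\<in>sorted_tuples (n - 1) (d 1). \<Sum>j\<in>{1..d 1}.
        goncharov_c' c u j * prod_list (map x u) * y j)
     + (\<Sum>m\<in>{2..n}. \<Sum>i\<in>{1..d m}. \<Sum>u\<in>sorted_tuples (n - m) (d 1).
        c (map Tau u @ [Sig m i]) * prod_list (map x u) * z m i)) (ad_e0 n))"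
proof -
  let ?ad = "\<lambda>u b. foldr (\<lambda>i. ad L (\<tau> i)) u b"
  let ?T = "\<Oplus>u\<in>sorted_tuples (n - 1) (d 1). \<Oplus>j\<in>{j\<in>{1..d 1}. j < last u}.
    c (map Tau (u @ [j])) \<odot> ?ad u (\<tau> j)"
  let ?S = "\<Oplus>m\<in>{2..n}. \<Oplus>i\<in>{1..d m}. \<Oplus>u\<in>sorted_tuples (n - m) (d 1).
    c (map Tau u @ [Sig m i]) \<odot> ?ad u (\<sigma> m i)"
  have T: "c (map Tau (u @ [j])) \<odot> ?ad u (\<tau> j) \<in> carrier L"
    "\<xi> (c (map Tau (u @ [j])) \<odot> ?ad u (\<tau> j)) = pl_class N (series_scale (c (map Tau (u @ [j])) *
      (prod_list (map x (butlast u)) * (x (last u) * y j - x j * y (last u)))) (ad_e0 n))"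
    if "u \<in> sorted_tuples (n - 1) (d 1)" "j \<in> {1..d 1}" for u j
  proof -
    have u: "u \<noteq> []" "set u \<subseteq> {1..d 1}" "Suc (length u) = n"
      using that assms by (auto simp: sorted_tuples_def)
    moreover have "?ad u (\<tau> j) \<in> carrier L"
      using u that generators(1) by (intro ad_tuple_carrier) auto
    ultimately show "c (map Tau (u @ [j])) \<odot> ?ad u (\<tau> j) \<in> carrier L"
      "\<xi> (c (map Tau (u @ [j])) \<odot> ?ad u (\<tau> j)) = pl_class N (series_scale (c (map Tau (u @ [j])) *
        (prod_list (map x (butlast u)) * (x (last u) * y j - x j * y (last u)))) (ad_e0 n))"
      using hom_ad_tuple_tau[OF u(1,2) that(2)]
      by (simp_all add: smult_closed hom_smult series_scale_scale)
  qed
  have S: "c (map Tau u @ [Sig m i]) \<odot> ?ad u (\<sigma> m i) \<in> carrier L"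
    "\<xi> (c (map Tau u @ [Sig m i]) \<odot> ?ad u (\<sigma> m i)) = pl_class N (series_scale
      (c (map Tau u @ [Sig m i]) * prod_list (map x u) * z m i) (ad_e0 n))"
    if "m \<in> {2..n}" "i \<in> {1..d m}" "u \<in> sorted_tuples (n - m) (d 1)" for m i u
  proof -
    have u: "set u \<subseteq> {1..d 1}" "length u + m = n"
      using that by (auto simp: sorted_tuples_def)
    have \<sigma>: "\<sigma> m i \<in> carrier L" "1 \<le> m" "\<xi> (\<sigma> m i) = pl_class N (series_scale (z m i) (ad_e0 m))"
      using that generators(2)[of m i] hom_sigma by auto
    show "c (map Tau u @ [Sig m i]) \<odot> ?ad u (\<sigma> m i) \<in> carrier L"
      "\<xi> (c (map Tau u @ [Sig m i]) \<odot> ?ad u (\<sigma> m i)) = pl_class N (series_scale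
        (c (map Tau u @ [Sig m i]) * prod_list (map x u) * z m i) (ad_e0 n))"
      using hom_ad_tuple[OF u(1) \<sigma>] ad_tuple_carrier[OF u(1) \<sigma>(1)] u(2)
      by (simp_all add: smult_closed hom_smult series_scale_scale mult.assoc)
  qed
  have "goncharov_term L d \<tau> \<sigma> c n = ?T \<oplus> ?S"
    using assms by (simp add: goncharov_term_def)
  moreover have "?T \<in> carrier L" "?S \<in> carrier L"
    using T(1) S(1) by (auto intro!: finsum_closed)
  moreover have "\<xi> ?T = pl_class N (series_scale
      (\<Sum>u\<in>sorted_tuples (n - 1) (d 1). \<Sum>j\<in>{j\<in>{1..d 1}. j < last u}. c (map Tau (u @ [j])) *
        (prod_list (map x (butlast u)) * (x (last u) * y j - x j * y (last u)))) (ad_e0 n))"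
    using T by (intro hom_finsum finsum_closed) auto
  moreover have "\<xi> ?S = pl_class N (series_scale
      (\<Sum>m\<in>{2..n}. \<Sum>i\<in>{1..d m}. \<Sum>u\<in>sorted_tuples (n - m) (d 1).
        c (map Tau u @ [Sig m i]) * prod_list (map x u) * z m i) (ad_e0 n))"
    using S by (intro hom_finsum finsum_closed) auto
  \<comment> \<open>The determinants over tuples of length \<open>n - 1 \<ge> 1\<close> are
    rewritten through \<open>goncharov_c'\<close>.\<close>
  ultimately show ?thesis
    using assms goncharov_c'_sum[of "n - 1" c x y "d 1"]
    by (simp add: hom_add series_scale_add_left)
qed

end

text \<open>The comparison uses one representative of \<open>\<xi> \<epsilon>\<close>: its degree
  \<open>-1\<close> part gives the terms in \<open>e0\<close> and \<open>e1\<close>, and the rest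
  represents the sum over \<open>n \<ge> 2\<close>. Writing that sum as
  \<open>homogeneous_sum\<close> covers finite and infinite \<open>N\<close> alike.\<close>

theorem theorem4p15:
  fixes N :: enat
    and LU :: "('r::rat_algebra, 'u) graded_lie"
    and d :: "nat \<Rightarrow> nat"
    and \<tau> :: "nat \<Rightarrow> 'u" and \<sigma> :: "nat \<Rightarrow> nat \<Rightarrow> 'u"
    and \<epsilon> :: 'u
    and c :: "mt_letter list \<Rightarrow> 'r"
    and \<xi> :: "'u \<Rightarrow> (pl_letter list \<Rightarrow> 'r) set"
    and x y :: "nat \<Rightarrow> 'r" and z :: "nat \<Rightarrow> nat \<Rightarrow> 'r"
    and k :: "nat \<Rightarrow> 'r"
  assumes "1 \<le> N"
    and "pronilpotent_graded_lie LU"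
    and "free_on_generators LU d \<tau> \<sigma>"
    and "\<epsilon> \<in> carrier LU"
    and "goncharov_coefficients LU d \<tau> \<sigma> \<epsilon> c"
    and "\<xi> \<in> hom_gr LU (PL N)"
    and "\<And>i. i \<in> {1..d 1} \<Longrightarrow> \<xi> (\<tau> i) = x i \<odot>\<^bsub>PL N\<^esub> e0 N \<oplus>\<^bsub>PL N\<^esub> y i \<odot>\<^bsub>PL N\<^esub> e1 N"
    and "\<And>n i. 2 \<le> n \<Longrightarrow> i \<in> {1..d n} \<Longrightarrow>
           \<xi> (\<sigma> n i) = z n i \<odot>\<^bsub>PL N\<^esub> (ad (PL N) (e0 N) ^^ (n - 1)) (e1 N)"
    and "\<And>n. 2 \<le> n \<Longrightarrow> k n =
           (\<Sum>u\<in>sorted_tuples (n - 1) (d 1). \<Sum>j\<in>{1..d 1}.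
              goncharov_c' c u j * prod_list (map x u) * y j)
           + (\<Sum>m\<in>{2..n}. \<Sum>i\<in>{1..d m}. \<Sum>u\<in>sorted_tuples (n - m) (d 1).
              c (map Tau u @ [Sig m i]) * prod_list (map x u) * z m i)"
  shows "cocycle_eval \<epsilon> \<xi> =
           (\<Sum>i\<in>{1..d 1}. c [Tau i] * x i) \<odot>\<^bsub>PL N\<^esub> e0 N
           \<oplus>\<^bsub>PL N\<^esub> (\<Sum>i\<in>{1..d 1}. c [Tau i] * y i) \<odot>\<^bsub>PL N\<^esub> e1 N
           \<oplus>\<^bsub>PL N\<^esub> homogeneous_sum (PL N) {n. 2 \<le> n \<and> enat n \<le> N}
              (\<lambda>n. k n \<odot>\<^bsub>PL N\<^esub> (ad (PL N) (e0 N) ^^ (n - 1)) (e1 N))"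
proof -
  interpret pl_evaluation LU N \<xi> d \<tau> \<sigma> x y z
  proof (intro pl_evaluation.intro pl_homomorphism.intro pl_homomorphism_axioms.intro
      pl_evaluation_axioms.intro)
    show "\<xi> (\<tau> i) =
        pl_class N (series_scale (x i) (letter E0) + series_scale (y i) (letter E1))"
      if "i \<in> {1..d 1}" for i
      using assms(7)[OF that] by (simp add: e0_def e1_def)
    show "\<xi> (\<sigma> n i) = pl_class N (series_scale (z n i) (ad_e0 n))"
      if "2 \<le> n" "i \<in> {1..d n}" for n i
      using assms(8)[OF that] that(1) by (simp add: PL_ad_power)
  qed (fact assms)+
  let ?G = "goncharov_term LU d \<tau> \<sigma> c"
  let ?A = "series_scale (\<Sum>i\<in>{1..d 1}. c [Tau i] * x i) (letter E0)"
  let ?B = "series_scale (\<Sum>i\<in>{1..d 1}. c [Tau i] * y i) (letter E1)"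
  obtain \<gamma> where \<gamma>: "\<gamma> \<in> goncharov_ideal LU" "\<epsilon> = homogeneous_sum LU {1..} ?G \<oplus>\<^bsub>LU\<^esub> \<gamma>"
    using assms(5) unfolding goncharov_coefficients_def by blast
  have G: "?G n \<in> homogeneous n" if "n \<in> {1..}" for n
    using goncharov_term_homogeneous[OF assms(3)] that by simp
  define H where "H = homogeneous_sum LU {1..} ?G"
  have H: "H \<in> carrier LU" "component LU n H = (if n \<in> {1..} then ?G n else \<zero>\<^bsub>LU\<^esub>)" for n
    unfolding H_def using component_homogeneous_sum[of "{1..}" ?G] G by auto
  have \<gamma>_carrier: "\<gamma> \<in> carrier LU"
    using \<gamma>(1) by (simp add: goncharov_ideal_def degree_closure_def)
  obtain f where f: "f \<in> carrier pl_free" "\<xi> \<epsilon> = pl_class N f"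
    using hom_lift[OF assms(4)] .
  \<comment> \<open>The Goncharov part maps to zero, so \<epsilon> and the sum \<open>H\<close> of
    its homogeneous terms have the same image, and \<xi> commutes with the projections.\<close>
  have part: "pl_class N (pl_part n f) = \<xi> (?G n)" if "1 \<le> n" for n
  proof -
    obtain h where h: "\<xi> H = pl_class N h" using hom_lift[OF H(1)] .
    have "\<xi> \<epsilon> = \<xi> H \<oplus>\<^bsub>PL N\<^esub> \<xi> \<gamma>"
      using hom_add[OF H(1) \<gamma>_carrier] by (simp only: \<gamma>(2) H_def)
    then have "\<xi> \<epsilon> = \<xi> H" by (simp add: h hom_goncharov_ideal[OF \<gamma>(1)])
    then have "pl_class N (pl_part n f) = \<xi> (component LU n H)"
      using hom_component[OF H(1), of n] PL_component[of N n f] f(2) by simp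
    then show ?thesis using H(2)[of n] that by simp
  qed
  have part_1: "pl_class N (pl_part 1 f) = pl_class N (?A + ?B)"
    using part[of 1] hom_goncharov_term_1 by simp
  have part_n: "pl_class N (pl_part n f) = pl_class N (series_scale (k n) (ad_e0 n))" if "2 \<le> n" for n
    using part[of n] hom_goncharov_term[OF that] assms(9)[OF that] that by simp
  have part_0: "pl_part 0 f = 0"
    using pl_free_Nil[OF f(1)]
    by (auto simp: series_part_def pl_word_weight fun_eq_iff zero_fun_apply)
  have "homogeneous_sum (PL N) {n. 2 \<le> n \<and> enat n \<le> N}
      (\<lambda>n. k n \<odot>\<^bsub>PL N\<^esub> (ad (PL N) (e0 N) ^^ (n - 1)) (e1 N)) = pl_class N (f - pl_part 1 f)"
  proof (rule PL_homogeneous_sum)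
    show "f - pl_part 1 f \<in> carrier pl_free" using f by (simp add: pl_free_closed)
    fix n
    consider "n = 0" | "n = 1" | "2 \<le> n" "enat n \<le> N" | "2 \<le> n" "N < enat n" by force
    then show "pl_class N (pl_part n (f - pl_part 1 f)) =
        (if n \<in> {n. 2 \<le> n \<and> enat n \<le> N}
         then k n \<odot>\<^bsub>PL N\<^esub> (ad (PL N) (e0 N) ^^ (n - 1)) (e1 N) else pl_class N 0)"
    proof cases
      case 3
      then show ?thesis
        using part_n by (simp add: series_part_diff series_part_part PL_ad_power del: One_nat_def)
    next
      \<comment> \<open>Beyond \<open>N\<close> the sum prescribes zero, and the term indeed
        vanishes because \<open>ad_e0 n\<close> is a relator.\<close>
      case 4
      then have "\<not> enat n \<le> N" "series_scale (k n) (ad_e0 n) \<in> pl_ideal N"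
        by (simp_all add: pl_ideal_closed ad_e0_in_pl_ideal)
      then show ?thesis
        using 4 part_n
        by (simp add: series_part_diff series_part_part pl_class_eq_zero_iff)
    qed (simp_all add: series_part_diff series_part_part part_0)
  qed
  \<comment> \<open>\<open>f\<close> is its degree \<open>-1\<close> part plus the rest, and that
    part may be replaced by \<open>?A + ?B\<close> modulo the ideal.\<close>
  moreover have "pl_class N f = pl_class N (?A + ?B + (f - pl_part 1 f))"
    using part_1 pl_ideal_closed(4)[of "pl_part 1 f - (?A + ?B)"]
    by (simp add: pl_class_eq_iff algebra_simps)
  ultimately show ?thesis
    by (simp add: cocycle_eval_def f(2) e0_def e1_def)
qed

end
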